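(* Let $K$ be a field, let $n\geq 3$ be an integer, let $S=K[x_1,\ldots,x_n]$, and let $J_n=(x_1x_2,\,x_2x_3,\ldots,x_{n-1}x_n,\,x_nx_1)\subset S$. Then $$\operatorname{sdepth}(S/J_n)\geq\left\lceil\frac{n-1}{3}\right\rceil.$$ In particular, $S/J_n$ satisfies the Stanley conjecture, i.e. $\operatorname{sdepth}(S/J_n)\geq\operatorname{depth}(S/J_n)$.
   Context: Let $M$ be a nonzero $\mathbb Z^n$-graded $S$-module. A Stanley decomposition of $M$ is a direct sum $\mathcal D: M=\bigoplus_{i=1}^r m_iK[Z_i]$ as $\mathbb Z^n$-graded $K$-vector spaces, where each $m_i\in M$ is homogeneous with respect to the $\mathbb Z^n$-grading, $Z_i\subset\{x_1,\ldots,x_n\}$, and $m_iK[Z_i]=\{um_i:\ u\in K[Z_i]\}\subset M$ is a free $K[Z_i]$-submodule of $M$. Put $\operatorname{sdepth}(\mathcal D)=\min_{i}|Z_i|$. The Stanley depth $\operatorname{sdepth}(M)$ is the maximum of $\operatorname{sdepth}(\mathcal D)$ over all Stanley decompositions $\mathcal D$ of $M$. The depth $\operatorname{depth}(M)$ is taken with respect to the graded maximal ideal $(x_1,\ldots,x_n)$. *)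

theory Defs
  imports Complex_Main "HOL-Library.Poly_Mapping" "HOL-Library.FuncSet"
    "HOL-Algebra.QuotRing" "HOL-Algebra.Module"
begin

section \<open>The polynomial ring\<close>

text \<open>The variables are indexed by positive naturals. A monomial is its exponent vector, a
  polynomial the finitely supported family of its coefficients.\<close>

type_synonym 'k mpoly = "(nat \<Rightarrow>\<^sub>0 nat) \<Rightarrow>\<^sub>0 'k"

text \<open>\<open>polys_in Z\<close> is \<open>K[Z]\<close>, where \<open>Z\<close> is given by the indices of its variables.\<close>

definition polys_in :: "nat set \<Rightarrow> 'k::field mpoly set" where
  "polys_in Z = {p. \<forall>m \<in> Poly_Mapping.keys p. Poly_Mapping.keys m \<subseteq> Z}"

definition poly_ring :: "nat \<Rightarrow> 'k::field mpoly ring" where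
  "poly_ring n = \<lparr>carrier = polys_in {1..n}, mult = (*), one = 1, zero = 0, add = (+)\<rparr>"

definition var :: "nat \<Rightarrow> 'k::field mpoly" where
  "var i = Poly_Mapping.single (Poly_Mapping.single i 1) 1"

text \<open>Degrees in \<open>\<int>\<^sup>n\<close> are integer vectors supported in \<open>{1..n}\<close>.\<close>

definition multidegrees :: "nat \<Rightarrow> (nat \<Rightarrow>\<^sub>0 int) set" where
  "multidegrees n = {a. Poly_Mapping.keys a \<subseteq> {1..n}}"

definition poly_component :: "nat \<Rightarrow> (nat \<Rightarrow>\<^sub>0 int) \<Rightarrow> 'k::field mpoly set" where
  "poly_component n a =
    {p \<in> carrier (poly_ring n). \<forall>m \<in> Poly_Mapping.keys p. Poly_Mapping.map int m = a}"


section \<open>The quotient of a ring by an ideal, as a module\<close>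

definition quot_module :: "('a, 'b) ring_scheme \<Rightarrow> 'a set \<Rightarrow> ('a, 'a set) module" where
  "quot_module R I =
    \<lparr>carrier = carrier (R Quot I), mult = mult (R Quot I), one = one (R Quot I),
     zero = zero (R Quot I), add = add (R Quot I),
     smult = (\<lambda>r X. (I +>\<^bsub>R\<^esub> r) \<otimes>\<^bsub>R Quot I\<^esub> X)\<rparr>"

text \<open>The grading induced on \<open>S/I\<close> when \<open>I\<close> is a monomial ideal.\<close>

definition quot_component ::
    "nat \<Rightarrow> 'k::field mpoly set \<Rightarrow> (nat \<Rightarrow>\<^sub>0 int) \<Rightarrow> 'k mpoly set set" where
  "quot_component n I a = (\<lambda>p. I +>\<^bsub>poly_ring n\<^esub> p) ` poly_component n a"


section \<open>Stanley depth\<close>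

text \<open>\<open>M\<close> is the direct sum of its additive subgroups \<open>U i\<close>, \<open>i \<in> I\<close>.\<close>

definition internal_direct_sum ::
    "('a, 'b, 'c) module_scheme \<Rightarrow> 'i set \<Rightarrow> ('i \<Rightarrow> 'b set) \<Rightarrow> bool" where
  "internal_direct_sum M I U \<longleftrightarrow>
    (\<forall>i\<in>I. additive_subgroup (U i) M) \<and>
    (\<forall>v\<in>carrier M. \<exists>!f. f \<in> (\<Pi>\<^sub>E i\<in>I. U i) \<and>
        finite {i\<in>I. f i \<noteq> \<zero>\<^bsub>M\<^esub>} \<and> v = finsum M f {i\<in>I. f i \<noteq> \<zero>\<^bsub>M\<^esub>})"

definition homogeneous_element :: "nat \<Rightarrow> ((nat \<Rightarrow>\<^sub>0 int) \<Rightarrow> 'b set) \<Rightarrow> 'b \<Rightarrow> bool" where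
  "homogeneous_element n G v \<longleftrightarrow> (\<exists>a\<in>multidegrees n. v \<in> G a)"

definition stanley_space :: "('k::field mpoly, 'b, 'c) module_scheme \<Rightarrow> 'b \<Rightarrow> nat set \<Rightarrow> 'b set" where
  "stanley_space M v Z = (\<lambda>u. u \<odot>\<^bsub>M\<^esub> v) ` polys_in Z"

text \<open>\<open>v K[Z]\<close> is free over \<open>K[Z]\<close> with basis \<open>v\<close>; in particular \<open>v \<noteq> 0\<close>.\<close>

definition stanley_free :: "('k::field mpoly, 'b, 'c) module_scheme \<Rightarrow> 'b \<Rightarrow> nat set \<Rightarrow> bool" where
  "stanley_free M v Z \<longleftrightarrow> (\<forall>u\<in>polys_in Z. u \<odot>\<^bsub>M\<^esub> v = \<zero>\<^bsub>M\<^esub> \<longrightarrow> u = 0)"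

text \<open>For an \<open>S\<close>-module \<open>M\<close> with homogeneous components \<open>G a\<close>, the list \<open>D\<close> of the pairs
  \<open>(m\<^sub>i, Z\<^sub>i)\<close> is a Stanley decomposition. As the \<open>m\<^sub>i\<close> are homogeneous, the \<open>m\<^sub>i K[Z\<^sub>i]\<close> are
  graded \<open>K\<close>-subspaces, so their sum is direct as graded vector spaces iff it is
  direct as abelian groups.\<close>

definition stanley_decomposition ::
    "nat \<Rightarrow> ('k::field mpoly, 'b, 'c) module_scheme \<Rightarrow> ((nat \<Rightarrow>\<^sub>0 int) \<Rightarrow> 'b set)
      \<Rightarrow> ('b \<times> nat set) list \<Rightarrow> bool" where
  "stanley_decomposition n M G D \<longleftrightarrow>
    (\<forall>(v, Z)\<in>set D. v \<in> carrier M \<and> homogeneous_element n G v \<and> Z \<subseteq> {1..n} \<and> stanley_free M v Z) \<and>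
    internal_direct_sum M {..<length D} (\<lambda>i. stanley_space M (fst (D ! i)) (snd (D ! i)))"

definition sdepth_decomposition :: "('b \<times> nat set) list \<Rightarrow> nat" where
  "sdepth_decomposition D = Min ((\<lambda>(v, Z). card Z) ` set D)"

text \<open>For \<open>M \<noteq> 0\<close> the set below is bounded by \<open>n\<close>.\<close>

definition sdepth ::
    "nat \<Rightarrow> ('k::field mpoly, 'b, 'c) module_scheme \<Rightarrow> ((nat \<Rightarrow>\<^sub>0 int) \<Rightarrow> 'b set) \<Rightarrow> nat" where
  "sdepth n M G = Max {sdepth_decomposition D | D. stanley_decomposition n M G D}"


section \<open>Depth\<close>

text \<open>The submodule \<open>(f\<^sub>1, \<dots>, f\<^sub>r) M\<close> of \<open>M\<close>.\<close>

definition seq_mult :: "('a, 'b, 'c) module_scheme \<Rightarrow> 'a list \<Rightarrow> 'b set" where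
  "seq_mult M fs =
    {finsum M (\<lambda>i. (fs ! i) \<odot>\<^bsub>M\<^esub> g i) {..<length fs} | g. g \<in> {..<length fs} \<rightarrow> carrier M}"

text \<open>Each \<open>f\<^sub>i\<close> is a nonzerodivisor on \<open>M / (f\<^sub>1, \<dots>, f\<^sub>i\<^sub>-\<^sub>1) M\<close>, and \<open>M / (f\<^sub>1, \<dots>, f\<^sub>r) M \<noteq> 0\<close>.\<close>

definition regular_sequence :: "('a, 'b, 'c) module_scheme \<Rightarrow> 'a list \<Rightarrow> bool" where
  "regular_sequence M fs \<longleftrightarrow>
    (\<forall>i<length fs. \<forall>v\<in>carrier M.
        (fs ! i) \<odot>\<^bsub>M\<^esub> v \<in> seq_mult M (take i fs) \<longrightarrow> v \<in> seq_mult M (take i fs)) \<and>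
    seq_mult M fs \<noteq> carrier M"

text \<open>The depth of \<open>M\<close> with respect to an ideal \<open>I\<close> of its ring of scalars.\<close>

definition depth :: "'a set \<Rightarrow> ('a, 'b, 'c) module_scheme \<Rightarrow> nat" where
  "depth I M = Max {length fs | fs. set fs \<subseteq> I \<and> regular_sequence M fs}"

definition graded_maximal_ideal :: "nat \<Rightarrow> 'k::field mpoly set" where
  "graded_maximal_ideal n = Idl\<^bsub>poly_ring n\<^esub> (var ` {1..n})"


section \<open>The edge ideal of the cycle\<close>

definition cycle_ideal :: "nat \<Rightarrow> 'k::field mpoly set" where
  "cycle_ideal n =
    Idl\<^bsub>poly_ring n\<^esub> ({var i * var (i + 1) | i. 1 \<le> i \<and> i < n} \<union> {var n * var 1})"


end

theory Submission
  imports Defs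
begin

text \<open>Both bounds are compared with \<open>d = (n + 1) div 3\<close>. For the Stanley depth, the independent sets
  of a cycle either avoid the vertex \<open>n\<close>, and are independent in a path with \<open>n - 1\<close> vertices, or
  contain it, and are otherwise independent in a path with \<open>n - 3\<close> vertices. The same recursion for
  paths partitions the independence complex into intervals whose upper ends have at least \<open>d\<close>
  elements, and an interval partition of the complex is a Stanley decomposition.

  For the depth, a regular sequence of length greater than \<open>p\<close> in the maximal ideal forces the Koszul
  cohomology in degree \<open>p\<close> of \<open>S/J\<close> to vanish, for any elements generating an ideal
  primary to the maximal ideal modulo \<open>J\<close>. A nonzero class in degree \<open>d\<close> comes from a facet with
  \<open>d\<close> elements unless \<open>n = 3 d + 1\<close>. In that case no such facet exists, and the class comes from a
  cocycle of the independence complex that does not vanish on the boundary of a cross-polytope.\<close>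

section \<open>Koszul complexes and regular sequences\<close>

text \<open>Since \<open>d\<close> is the ceiling of (n - 1)/3, bounding depth from above and
  Stanley depth from below by \<open>d\<close> yields both claims. Members of a regular sequence may
  be arbitrary inhomogeneous elements of the maximal ideal. Koszul cohomology moves the problem to a
  list of elements of one's own choice, and the list is chosen so that a class is seen to be nonzero
  by reading off coefficients. For a facet F the monomial x_F generates a copy of K[F] in S/J, which
  bounds the depth by |F|. A maximal independent set of the cycle has at least n/3 vertices, and for
  n = 3d + 1 this exceeds d, so facets fail by one. The class used there is topological: the
  independence complex is a homotopy (d-1)-sphere, and by Hochster's formula its cohomology appears
  in the local cohomology of S/J in degree d. The edges {3i + 1, 3i + 2} are pairwise not joined in
  the cycle, so choosing one end of each gives independent sets; these are the facets of a
  cross-polytope boundary, which carries the fundamental class.\<close>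

text \<open>A cochain assigns a value to each subset of the list \<open>ys\<close>, encoded by its characteristic
  bit list; the complex of \<open>y # ys\<close> is the mapping cone of \<open>y\<close> on the complex of \<open>ys\<close>. Values on
  bit lists of the wrong length carry no information.\<close>

primrec koszul :: "'a::comm_ring_1 list \<Rightarrow> (bool list \<Rightarrow> 'a) \<Rightarrow> bool list \<Rightarrow> 'a" where
  "koszul [] c l = 0"
| "koszul (y # ys) c l = (case l of [] \<Rightarrow> 0 | b # l' \<Rightarrow>
     if b then y * c (False # l') - koszul ys (\<lambda>l. c (True # l)) l'
     else koszul ys (\<lambda>l. c (False # l)) l')"

text \<open>\<open>koszul ys\<close> is exterior multiplication by the vector \<open>ys\<close>;
  this is contraction with the covector \<open>as\<close>. The minus signs come from passing the
  first basis vector.\<close>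

primrec homotopy :: "'a::comm_ring_1 list \<Rightarrow> (bool list \<Rightarrow> 'a) \<Rightarrow> bool list \<Rightarrow> 'a" where
  "homotopy [] c l = 0"
| "homotopy (a # as) c l = (case l of [] \<Rightarrow> 0 | b # l' \<Rightarrow>
     if b then - homotopy as (\<lambda>l. c (True # l)) l'
     else a * c (True # l') + homotopy as (\<lambda>l. c (False # l)) l')"

section \<open>Linearity, Cartan formula and degrees of the two operators\<close>

lemma koszul_add: "koszul ys (\<lambda>l. c l + d l) l = koszul ys c l + koszul ys d l"
  by (induction ys arbitrary: c d l) (auto simp: algebra_simps split: list.split)

lemma koszul_mult: "koszul ys (\<lambda>l. a * c l) l = a * koszul ys c l"
  by (induction ys arbitrary: c l) (auto simp: algebra_simps split: list.split)

lemma koszul_diff: "koszul ys (\<lambda>l. c l - d l) l = koszul ys c l - koszul ys d l"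
  by (induction ys arbitrary: c d l) (auto simp: algebra_simps split: list.split)

lemma koszul_zero [simp]: "koszul ys (\<lambda>l. 0) l = 0"
  using koszul_mult[of ys 0 "\<lambda>l. 0" l] by simp

lemma koszul_uminus: "koszul ys (\<lambda>l. - c l) l = - koszul ys c l"
  using koszul_mult[of ys "-1" c l] by simp

lemma homotopy_mult: "homotopy as (\<lambda>l. a * c l) l = a * homotopy as c l"
  by (induction as arbitrary: c l) (auto simp: algebra_simps split: list.split)

lemma homotopy_diff: "homotopy ys (\<lambda>l. c l - d l) l = homotopy ys c l - homotopy ys d l"
  by (induction ys arbitrary: c d l) (auto simp: algebra_simps split: list.split)

lemma koszul_koszul [simp]: "koszul ys (koszul ys c) l = 0"
  by (induction ys arbitrary: c l) (auto simp: koszul_mult koszul_diff split: list.split)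

text \<open>Contraction is an antiderivation of the exterior algebra. As a consequence, every
  element of the ideal generated by \<open>ys\<close> annihilates the Koszul cohomology.\<close>

lemma koszul_homotopy:
  assumes "length as = length ys" "length l = length ys"
  shows "koszul ys (homotopy as c) l + homotopy as (koszul ys c) l
    = (\<Sum>i<length ys. as ! i * ys ! i) * c l"
  using assms
proof (induction as ys arbitrary: c l rule: list_induct2)
  case Nil
  then show ?case by simp
next
  case (Cons a as y ys)
  then obtain b l' where l: "l = b # l'" "length l' = length ys"
    by (cases l) auto
  have s: "(\<Sum>i<length (y # ys). (a # as) ! i * (y # ys) ! i)
      = a * y + (\<Sum>i<length ys. as ! i * ys ! i)"
    by (simp only: length_Cons sum.lessThan_Suc_shift) simp
  have IH: "koszul ys (homotopy as c') l' = (\<Sum>i<length ys. as ! i * ys ! i) * c' l'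
      - homotopy as (koszul ys c') l'" for c'
    using Cons.IH[OF l(2), of c'] by (simp add: algebra_simps)
  show ?case
    unfolding s using l(1)
    by (cases b) (simp_all add: koszul_add koszul_diff koszul_mult homotopy_mult homotopy_diff
        IH[of "\<lambda>l. c (True # l)"] IH[of "\<lambda>l. c (False # l)"]
        koszul_uminus algebra_simps)
qed

text \<open>The Koszul complex of a concatenation is a tensor product; the sign counts the basis
  vectors from \<open>ys\<close> that the second differential has to pass.\<close>

lemma koszul_append:
  assumes "length l = length ys"
  shows "koszul (ys @ zs) c (l @ l') = koszul ys (\<lambda>l. c (l @ l')) l
    + (-1) ^ count_list l True * koszul zs (\<lambda>l'. c (l @ l')) l'"
  using assms
proof (induction ys arbitrary: c l)
  case (Cons y ys)
  then obtain b k where "l = b # k" "length k = length ys"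
    by (cases l) auto
  then show ?case
    using Cons.IH by (cases b) (simp_all add: algebra_simps)
qed simp

lemma koszul_replicate_True:
  "koszul ys c (replicate (length ys) True)
    = (\<Sum>i<length ys. (-1) ^ i * ys ! i * c ((replicate (length ys) True)[i := False]))"
proof (induction ys arbitrary: c)
  case (Cons y ys)
  show ?case
    by (simp add: Cons.IH sum.lessThan_Suc_shift sum_negf mult.assoc del: sum.lessThan_Suc)
qed simp

text \<open>Cochains of degree p are the functions supported on bit lists with p entries
  \<open>True\<close>, so the degree of the differential becomes a statement on supports.\<close>

lemma koszul_weight:
  assumes "\<And>l. c l \<noteq> 0 \<Longrightarrow> count_list l True = p" "koszul ys c l \<noteq> 0"
  shows "count_list l True = Suc p"
  using assms
proof (induction ys arbitrary: c l p)
  case (Cons y ys)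
  then obtain b k where l: "l = b # k"
    by (auto split: list.splits)
  show ?case
  proof (cases b)
    case True
    then have "c (False # k) \<noteq> 0 \<or> koszul ys (\<lambda>l. c (True # l)) k \<noteq> 0"
      using Cons.prems(2) l by auto
    then show ?thesis
    proof
      assume "c (False # k) \<noteq> 0"
      then show ?thesis
        using Cons.prems(1)[of "False # k"] l True by simp
    next
      assume nz: "koszul ys (\<lambda>l. c (True # l)) k \<noteq> 0"
      have "\<exists>l. c (True # l) \<noteq> 0"
      proof (rule ccontr)
        assume "\<nexists>l. c (True # l) \<noteq> 0"
        then have "(\<lambda>l. c (True # l)) = (\<lambda>l. 0)"
          by auto
        then show False
          using nz by simp
      qed
      then obtain q where q: "p = Suc q"
        using Cons.prems(1)[of "True # _"] by (cases p) auto
      have "count_list l True = q" if "c (True # l) \<noteq> 0" for l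
        using Cons.prems(1)[OF that] q by simp
      then have "count_list k True = Suc q"
        by (rule Cons.IH[OF _ nz])
      then show ?thesis
        using l True q by simp
    qed
  next
    case False
    then have "count_list k True = Suc p"
      using Cons.prems(2) l Cons.prems(1)[of "False # _"]
      by (intro Cons.IH[of "\<lambda>l. c (False # l)"]) auto
    then show ?thesis
      using l False by simp
  qed
qed simp

lemma homotopy_weight:
  assumes "\<And>l. c l \<noteq> 0 \<Longrightarrow> count_list l True = p" "homotopy as c l \<noteq> 0"
  shows "Suc (count_list l True) = p"
  using assms
proof (induction as arbitrary: c l p)
  case (Cons a as)
  then obtain b k where l: "l = b # k"
    by (auto split: list.splits)
  show ?case
  proof (cases b)
    case True
    then have nz: "homotopy as (\<lambda>l. c (True # l)) k \<noteq> 0"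
      using Cons.prems(2) l by auto
    have "count_list l True = p - 1" if "c (True # l) \<noteq> 0" for l
      using Cons.prems(1)[OF that] by simp
    then have "Suc (count_list k True) = p - 1"
      by (rule Cons.IH[OF _ nz])
    then show ?thesis
      using l True by simp
  next
    case False
    then have "c (True # k) \<noteq> 0 \<or> homotopy as (\<lambda>l. c (False # l)) k \<noteq> 0"
      using Cons.prems(2) l by auto
    then show ?thesis
    proof
      assume "c (True # k) \<noteq> 0"
      then show ?thesis
        using Cons.prems(1)[of "True # k"] l False by simp
    next
      assume nz: "homotopy as (\<lambda>l. c (False # l)) k \<noteq> 0"
      have "Suc (count_list k True) = p"
        using Cons.prems(1)[of "False # _"] by (intro Cons.IH[OF _ nz]) auto
      then show ?thesis
        using l False by simp
    qed
  qed
qed simp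

text \<open>The polynomials in n variables form a subset of a type with infinitely many variables.
  Computing in the type and tracking only membership in \<open>A\<close> keeps the Koszul
  calculations within type class arithmetic.\<close>

locale subring_set =
  fixes A :: "'a::comm_ring_1 set"
  assumes one_mem: "1 \<in> A"
    and diff_mem: "x \<in> A \<Longrightarrow> y \<in> A \<Longrightarrow> x - y \<in> A"
    and mult_mem: "x \<in> A \<Longrightarrow> y \<in> A \<Longrightarrow> x * y \<in> A"
begin

lemma zero_mem: "0 \<in> A"
  using diff_mem[OF one_mem one_mem] by simp

lemma uminus_mem: "x \<in> A \<Longrightarrow> - x \<in> A"
  using diff_mem[OF zero_mem] by simp

lemma add_mem: "x \<in> A \<Longrightarrow> y \<in> A \<Longrightarrow> x + y \<in> A"
  using diff_mem[of x "- y"] uminus_mem by simp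

lemma power_mem: "x \<in> A \<Longrightarrow> x ^ e \<in> A"
  by (induction e) (auto simp: one_mem mult_mem)

lemma sum_mem: "(\<And>i. i \<in> I \<Longrightarrow> f i \<in> A) \<Longrightarrow> sum f I \<in> A"
  by (induction I rule: infinite_finite_induct) (auto simp: zero_mem add_mem)

definition ideal_set :: "'a set \<Rightarrow> bool" where
  "ideal_set Q \<longleftrightarrow> Q \<subseteq> A \<and> 0 \<in> Q \<and> (\<forall>x\<in>Q. \<forall>y\<in>Q. x + y \<in> Q) \<and> (\<forall>x\<in>Q. \<forall>a\<in>A. a * x \<in> Q)"

lemma ideal_setD:
  assumes "ideal_set Q"
  shows "x \<in> Q \<Longrightarrow> x \<in> A" and "0 \<in> Q" and "x \<in> Q \<Longrightarrow> y \<in> Q \<Longrightarrow> x + y \<in> Q"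
    and "x \<in> Q \<Longrightarrow> a \<in> A \<Longrightarrow> a * x \<in> Q" and "x \<in> Q \<Longrightarrow> - x \<in> Q"
    and "x \<in> Q \<Longrightarrow> y \<in> Q \<Longrightarrow> x - y \<in> Q"
proof -
  show 1: "x \<in> Q \<Longrightarrow> x \<in> A" and 2: "0 \<in> Q" and 3: "x \<in> Q \<Longrightarrow> y \<in> Q \<Longrightarrow> x + y \<in> Q"
    and 4: "x \<in> Q \<Longrightarrow> a \<in> A \<Longrightarrow> a * x \<in> Q" for x y a
    using assms unfolding ideal_set_def by blast+
  show 5: "x \<in> Q \<Longrightarrow> - x \<in> Q" for x
    using 4[of x "-1"] uminus_mem[OF one_mem] by simp
  show "x \<in> Q \<Longrightarrow> y \<in> Q \<Longrightarrow> x - y \<in> Q"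
    using 3[of x "- y"] 5 by simp
qed

lemma ideal_set_sum:
  assumes "ideal_set Q" "\<And>i. i \<in> I \<Longrightarrow> f i \<in> Q"
  shows "sum f I \<in> Q"
  using assms(2) by (induction I rule: infinite_finite_induct) (auto intro: ideal_setD[OF assms(1)])

definition adjoin :: "'a set \<Rightarrow> 'a \<Rightarrow> 'a set" where
  "adjoin Q f = {q + f * a | q a. q \<in> Q \<and> a \<in> A}"

lemma ideal_set_adjoin:
  assumes "ideal_set Q" "f \<in> A"
  shows "ideal_set (adjoin Q f)"
  unfolding ideal_set_def
proof (intro conjI ballI)
  note Q = ideal_setD[OF assms(1)]
  show "adjoin Q f \<subseteq> A"
    unfolding adjoin_def using Q(1) assms(2) by (auto intro: add_mem mult_mem)
  show "0 \<in> adjoin Q f"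
    unfolding adjoin_def using Q(2) zero_mem by force
  fix x assume "x \<in> adjoin Q f"
  then obtain q a where x: "x = q + f * a" "q \<in> Q" "a \<in> A"
    unfolding adjoin_def by auto
  show "x + y \<in> adjoin Q f" if y: "y \<in> adjoin Q f" for y
  proof -
    from y obtain q' a' where y: "y = q' + f * a'" "q' \<in> Q" "a' \<in> A"
      unfolding adjoin_def by auto
    have "x + y = (q + q') + f * (a + a')"
      by (simp add: x y algebra_simps)
    then show ?thesis
      unfolding adjoin_def using x y Q(3) add_mem by blast
  qed
  show "b * x \<in> adjoin Q f" if "b \<in> A" for b
  proof -
    have "b * x = b * q + f * (b * a)"
      by (simp add: x algebra_simps)
    then show ?thesis
      unfolding adjoin_def using x that Q(4) mult_mem by blast
  qed
qed

lemma adjoin_mem: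
  assumes "ideal_set Q" "f \<in> A"
  shows "f \<in> adjoin Q f"
proof -
  have "f = 0 + f * 1"
    by simp
  then show ?thesis
    unfolding adjoin_def using ideal_setD(2)[OF assms(1)] one_mem by blast
qed

lemma subset_adjoin: "Q \<subseteq> adjoin Q f"
proof
  fix q assume "q \<in> Q"
  then have "q + f * 0 \<in> adjoin Q f"
    unfolding adjoin_def using zero_mem by blast
  then show "q \<in> adjoin Q f"
    by simp
qed

text \<open>Induction along a regular sequence adjoins one element at a time, whereas membership
  tests use this closed form of the generated ideal.\<close>

lemma foldl_adjoin:
  assumes "ideal_set Q" "set fs \<subseteq> A"
  shows "foldl adjoin Q fs = {q + (\<Sum>i<length fs. fs ! i * a i) | q a. q \<in> Q \<and> (\<forall>i<length fs. a i \<in> A)}"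
  using assms(2)
proof (induction fs rule: rev_induct)
  case Nil
  then show ?case by simp
next
  case (snoc f fs)
  have "foldl adjoin Q (fs @ [f]) = adjoin {q + (\<Sum>i<length fs. fs ! i * a i) | q a.
      q \<in> Q \<and> (\<forall>i<length fs. a i \<in> A)} f"
    using snoc by simp
  also have "\<dots> = {q + (\<Sum>i<length (fs @ [f]). (fs @ [f]) ! i * a i) | q a.
      q \<in> Q \<and> (\<forall>i<length (fs @ [f]). a i \<in> A)}" (is "?L = ?R")
  proof (intro equalityI subsetI)
    fix x assume "x \<in> ?L"
    then obtain q a b where x: "x = q + (\<Sum>i<length fs. fs ! i * a i) + f * b" "q \<in> Q"
        "\<forall>i<length fs. a i \<in> A" "b \<in> A"
      unfolding adjoin_def by auto
    have "(\<Sum>i<length fs. (fs @ [f]) ! i * (a(length fs := b)) i) = (\<Sum>i<length fs. fs ! i * a i)"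
      by (intro sum.cong) (auto simp: nth_append)
    then have "x = q + (\<Sum>i<length (fs @ [f]). (fs @ [f]) ! i * (a(length fs := b)) i)"
      by (simp add: x add.assoc)
    moreover have "\<forall>i<length (fs @ [f]). (a(length fs := b)) i \<in> A"
      using x by (auto simp: less_Suc_eq)
    ultimately show "x \<in> ?R"
      using x(2) by blast
  next
    fix x assume "x \<in> ?R"
    then obtain q a where x: "x = q + (\<Sum>i<length (fs @ [f]). (fs @ [f]) ! i * a i)" "q \<in> Q"
        "\<forall>i<length (fs @ [f]). a i \<in> A"
      by blast
    have "(\<Sum>i<length fs. (fs @ [f]) ! i * a i) = (\<Sum>i<length fs. fs ! i * a i)"
      by (intro sum.cong) (auto simp: nth_append)
    then have "x = (q + (\<Sum>i<length fs. fs ! i * a i)) + f * a (length fs)"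
      by (simp add: x add.assoc)
    then show "x \<in> ?L"
      unfolding adjoin_def using x(2,3) by (force simp: less_Suc_eq)
  qed
  finally show ?case .
qed

lemma ideal_set_foldl_adjoin:
  assumes "ideal_set Q" "set fs \<subseteq> A"
  shows "ideal_set (foldl adjoin Q fs)"
  using assms by (induction fs arbitrary: Q) (auto simp: ideal_set_adjoin)

text \<open>These are the weakly regular sequences on the quotient of \<open>A\<close> by
  \<open>Q\<close>, expressed on representatives.\<close>

definition regular_on :: "'a set \<Rightarrow> 'a list \<Rightarrow> bool" where
  "regular_on Q fs \<longleftrightarrow> (\<forall>i<length fs. \<forall>v\<in>A.
     fs ! i * v \<in> foldl adjoin Q (take i fs) \<longrightarrow> v \<in> foldl adjoin Q (take i fs))"

lemma regular_on_Cons: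
  assumes "regular_on Q (f # fs)"
  shows "v \<in> A \<Longrightarrow> f * v \<in> Q \<Longrightarrow> v \<in> Q" and "regular_on (adjoin Q f) fs"
proof -
  have *: "i < length (f # fs) \<Longrightarrow> v \<in> A \<Longrightarrow> (f # fs) ! i * v \<in> foldl adjoin Q (take i (f # fs)) \<Longrightarrow>
      v \<in> foldl adjoin Q (take i (f # fs))" for i v
    using assms unfolding regular_on_def by blast
  show "v \<in> A \<Longrightarrow> f * v \<in> Q \<Longrightarrow> v \<in> Q"
    using *[of 0] by simp
  show "regular_on (adjoin Q f) fs"
    unfolding regular_on_def using *[of "Suc _"] by simp
qed

lemma koszul_mem:
  assumes "ideal_set Q" "set ys \<subseteq> A" "\<And>l. length l = length ys \<Longrightarrow> c l \<in> Q" "length l = length ys"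
  shows "koszul ys c l \<in> Q"
  using assms(2-4)
  by (induction ys arbitrary: c l) (auto split: list.split intro!: ideal_setD[OF assms(1)])

lemma homotopy_mem:
  assumes "ideal_set Q" "set as \<subseteq> A" "\<And>l. length l = length as \<Longrightarrow> c l \<in> Q" "length l = length as"
  shows "homotopy as c l \<in> Q"
  using assms(2-4)
  by (induction as arbitrary: c l) (auto split: list.split intro!: ideal_setD[OF assms(1)])

text \<open>Cocycle conditions modulo \<open>Q\<close> hold on bit lists of the right length, but
  values in \<open>A\<close> are maintained on all lists; hence this second version.\<close>

lemma koszul_mem': "set ys \<subseteq> A \<Longrightarrow> (\<And>l. c l \<in> A) \<Longrightarrow> koszul ys c l \<in> A"
  by (induction ys arbitrary: c l) (auto split: list.split intro!: zero_mem diff_mem mult_mem)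

lemma homotopy_mem': "set as \<subseteq> A \<Longrightarrow> (\<And>l. c l \<in> A) \<Longrightarrow> homotopy as c l \<in> A"
  by (induction as arbitrary: c l)
    (auto split: list.split intro!: zero_mem uminus_mem add_mem mult_mem)

text \<open>Multiplication by \<open>f\<close> is injective on the cohomology in degree \<open>p\<close> because the cohomology of the
  quotient by \<open>f\<close> vanishes in degree \<open>p - 1\<close>; since a power of \<open>f\<close> annihilates the cohomology, it
  vanishes.\<close>

lemma koszul_exact:
  assumes "ideal_set Q" "set ys \<subseteq> A" "set fs \<subseteq> A" "regular_on Q fs" "p < length fs"
    and "\<And>f. f \<in> set fs \<Longrightarrow> \<exists>e as. length as = length ys \<and> set as \<subseteq> A \<and>
      f ^ e - (\<Sum>i<length ys. as ! i * ys ! i) \<in> Q"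
    and "\<And>l. c l \<in> A" "\<And>l. c l \<noteq> 0 \<Longrightarrow> count_list l True = p"
    and "\<And>l. length l = length ys \<Longrightarrow> koszul ys c l \<in> Q"
  shows "\<exists>b. (\<forall>l. b l \<in> A) \<and> (\<forall>l. b l \<noteq> 0 \<longrightarrow> Suc (count_list l True) = p) \<and>
    (\<forall>l. length l = length ys \<longrightarrow> c l - koszul ys b l \<in> Q)"
  using assms
proof (induction p arbitrary: Q fs c rule: less_induct)
  case (less p)
  note Q = ideal_setD[OF less.prems(1)] and ys = less.prems(2)
  let ?exact = "\<lambda>c. \<exists>b. (\<forall>l. b l \<in> A) \<and> (\<forall>l. b l \<noteq> 0 \<longrightarrow> Suc (count_list l True) = p) \<and>
    (\<forall>l. length l = length ys \<longrightarrow> c l - koszul ys b l \<in> Q)"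
  obtain f gs where fs: "fs = f # gs"
    using less.prems(5) by (cases fs) auto
  have f: "f \<in> A"
    using less.prems(3) fs by simp
  note reg = regular_on_Cons[OF less.prems(4)[unfolded fs]]
  have injective: "?exact c"
    if c: "\<And>l. c l \<in> A" "\<And>l. length l = length ys \<Longrightarrow> koszul ys c l \<in> Q"
      and "?exact (\<lambda>l. f * c l)" for c
  proof -
    from that(3) obtain b where b: "\<And>l. b l \<in> A" "\<And>l. b l \<noteq> 0 \<Longrightarrow> Suc (count_list l True) = p"
        "\<And>l. length l = length ys \<Longrightarrow> f * c l - koszul ys b l \<in> Q"
      by blast
    have "\<exists>b'. (\<forall>l. b' l \<in> A) \<and> (\<forall>l. b' l \<noteq> 0 \<longrightarrow> Suc (count_list l True) = p) \<and>
        (\<forall>l. length l = length ys \<longrightarrow> f * (c l - koszul ys b' l) \<in> Q)"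
    \<comment> \<open>In degree 0 there are no cochains of lower degree, so \<open>b\<close> is zero
      and f * c already lies in \<open>Q\<close>.\<close>
    proof (cases p)
      case 0
      then have "b = (\<lambda>l. 0)"
        using b(2) by auto
      then show ?thesis
        using b by (intro exI[of _ b]) auto
    next
      case (Suc q)
      note sub = subset_adjoin[of Q f, THEN subsetD]
      \<comment> \<open>The coboundary of \<open>b\<close> is f * c modulo \<open>Q\<close>, so
        \<open>b\<close> is a cocycle of degree p - 1 modulo \<open>Q\<close> and f, where the
        remaining sequence \<open>gs\<close> is regular.\<close>
      have "\<exists>e. (\<forall>l. e l \<in> A) \<and> (\<forall>l. e l \<noteq> 0 \<longrightarrow> Suc (count_list l True) = q) \<and>
        (\<forall>l. length l = length ys \<longrightarrow> b l - koszul ys e l \<in> adjoin Q f)"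
      proof (rule less.IH[of q _ gs])
        show "\<exists>e as. length as = length ys \<and> set as \<subseteq> A \<and>
            g ^ e - (\<Sum>i<length ys. as ! i * ys ! i) \<in> adjoin Q f" if "g \<in> set gs" for g
          using less.prems(6)[of g] that fs sub by fastforce
        show "koszul ys b l \<in> adjoin Q f" if "length l = length ys" for l
        proof -
          have "koszul ys b l = - (f * c l - koszul ys b l) + f * c l"
            by simp
          then show ?thesis
            unfolding adjoin_def using Q(5)[OF b(3)[OF that]] c(1) by blast
        qed
      qed (use Suc less.prems fs reg(2) b ideal_set_adjoin f in auto)
      then obtain e where e: "\<And>l. e l \<in> A" "\<And>l. e l \<noteq> 0 \<Longrightarrow> Suc (count_list l True) = q"
        "\<And>l. length l = length ys \<Longrightarrow> b l - koszul ys e l \<in> adjoin Q f"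
        by blast
      \<comment> \<open>The quotient by f is chosen separately on each list, and as 0 off degree p -
        1, so that \<open>b'\<close> is again homogeneous. There \<open>b\<close> and the coboundary
        of \<open>e\<close> vanish as well.\<close>
      have "\<exists>v\<in>A. (v \<noteq> 0 \<longrightarrow> Suc (count_list l True) = p) \<and>
          (length l = length ys \<longrightarrow> b l - koszul ys e l - f * v \<in> Q)" for l
      proof (cases "length l = length ys \<and> Suc (count_list l True) = p")
        case True
        then obtain q a where "b l - koszul ys e l = q + f * a" "q \<in> Q" "a \<in> A"
          using e(3)[of l] unfolding adjoin_def by auto
        then show ?thesis
          using True by (intro bexI[of _ a]) auto
      next
        case False
        have "koszul ys e l = 0" if "Suc (count_list l True) \<noteq> p"
        proof (rule ccontr)
          assume "koszul ys e l \<noteq> 0"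
          \<comment> \<open>The subtraction is truncated, so q = 0 is excluded separately: it would
            force \<open>e\<close> to be zero.\<close>
          then have "count_list l True = Suc (q - 1)"
            using e(2) by (intro koszul_weight[of e]) fastforce+
          moreover have "q \<noteq> 0"
          proof
            assume "q = 0"
            then have "e = (\<lambda>l. 0)"
              using e(2) by auto
            then show False
              using \<open>koszul ys e l \<noteq> 0\<close> by simp
          qed
          ultimately show False
            using that Suc by simp
        qed
        moreover have "b l = 0" if "Suc (count_list l True) \<noteq> p"
          using b(2) that by blast
        ultimately show ?thesis
          using False Q(2) zero_mem by (intro bexI[of _ 0]) auto
      qed
      then obtain b' where b': "\<And>l. b' l \<in> A" "\<And>l. b' l \<noteq> 0 \<Longrightarrow> Suc (count_list l True) = p"
          "\<And>l. length l = length ys \<Longrightarrow> b l - koszul ys e l - f * b' l \<in> Q"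
        by metis
      have "f * (c l - koszul ys b' l) \<in> Q" if l: "length l = length ys" for l
      proof -
        \<comment> \<open>Applying the differential removes \<open>e\<close>, as the differential
          squares to zero; adding f * c - d b then leaves f * (c - d b') in
          \<open>Q\<close>.\<close>
        have "koszul ys (\<lambda>l. b l - koszul ys e l - f * b' l) l \<in> Q"
          using koszul_mem[OF less.prems(1) ys _ l] b'(3) by simp
        then have "koszul ys b l - f * koszul ys b' l \<in> Q"
          by (simp add: koszul_diff koszul_mult)
        from Q(3)[OF b(3)[OF l] this] show ?thesis
          by (simp add: algebra_simps)
      qed
      then show ?thesis
        using b' by blast
    qed
    then obtain b' where b': "\<And>l. b' l \<in> A" "\<And>l. b' l \<noteq> 0 \<Longrightarrow> Suc (count_list l True) = p"
        "\<And>l. length l = length ys \<Longrightarrow> f * (c l - koszul ys b' l) \<in> Q"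
      by blast
    then show ?thesis
      using reg(1) c(1) koszul_mem'[OF ys] diff_mem by blast
  qed
  obtain e as where as: "length as = length ys" "set as \<subseteq> A"
      "f ^ e - (\<Sum>i<length ys. as ! i * ys ! i) \<in> Q"
    using less.prems(6)[of f] fs by auto
  \<comment> \<open>The contraction of \<open>c\<close> bounds f ^ e * c up to the contraction of d
    c, which lies in \<open>Q\<close>. The factors f are then cancelled one at a time by
    \<open>injective\<close>.\<close>
  have "?exact (\<lambda>l. f ^ e * c l)"
  proof (intro exI[of _ "homotopy as c"] conjI allI impI)
    show "homotopy as c l \<in> A" for l
      using homotopy_mem' as(2) less.prems(7) by blast
    show "Suc (count_list l True) = p" if "homotopy as c l \<noteq> 0" for l
      using homotopy_weight that less.prems(8) by blast
    show "f ^ e * c l - koszul ys (homotopy as c) l \<in> Q" if l: "length l = length ys" for l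
    proof -
      have "homotopy as (koszul ys c) l \<in> Q"
        using homotopy_mem[OF less.prems(1) as(2)] less.prems(9) l as(1) by simp
      then have "c l * (f ^ e - (\<Sum>i<length ys. as ! i * ys ! i)) + homotopy as (koszul ys c) l \<in> Q"
        using Q(3,4) as(3) less.prems(7) by blast
      moreover have "f ^ e * c l - koszul ys (homotopy as c) l
        = c l * (f ^ e - (\<Sum>i<length ys. as ! i * ys ! i)) + homotopy as (koszul ys c) l"
        using koszul_homotopy[OF as(1) l, of c] by (simp add: algebra_simps)
      ultimately show ?thesis
        by simp
    qed
  qed
  then show ?case
  proof (induction e)
    case 0
    then show ?case by simp
  next
    case (Suc e)
    have "?exact (\<lambda>l. f ^ e * c l)"
    proof (rule injective)
      show "f ^ e * c l \<in> A" for l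
        using f less.prems(7) power_mem mult_mem by blast
      show "koszul ys (\<lambda>l. f ^ e * c l) l \<in> Q" if "length l = length ys" for l
        using less.prems(9)[OF that] Q(4) f power_mem by (simp add: koszul_mult)
      show "?exact (\<lambda>l. f * (f ^ e * c l))"
        using Suc.prems by (simp add: mult.assoc)
    qed
    then show ?case
      by (rule Suc.IH)
  qed
qed

text \<open>Each term of the differential has a member of \<open>ys\<close> as a factor. This
  applies both to multipliers that kill the cochain modulo \<open>Q\<close> and to multipliers that
  themselves lie in the ideal.\<close>

lemma koszul_annihilated:
  assumes "ideal_set Q" "\<And>y l. y \<in> set ys \<Longrightarrow> y * c l \<in> Q"
  shows "koszul ys c l \<in> Q"
  using assms(2)
  by (induction ys arbitrary: c l) (auto split: list.split intro!: ideal_setD(2,6)[OF assms(1)])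

lemma koszul_replicate_False: "koszul ys c (replicate (length ys) False) = 0"
  by (induction ys arbitrary: c) auto

lemma subset_foldl_adjoin: "Q \<subseteq> foldl adjoin Q ys"
proof (induction ys arbitrary: Q)
  case (Cons y ys)
  then show ?case
    using subset_adjoin[of Q y] by (simp, blast)
qed simp

lemma mem_foldl_adjoin:
  assumes "ideal_set Q" "set ys \<subseteq> A" "y \<in> set ys"
  shows "y \<in> foldl adjoin Q ys"
  using assms
proof (induction ys arbitrary: Q)
  case (Cons z ys)
  have "z \<in> foldl adjoin (adjoin Q z) ys"
    using Cons.prems adjoin_mem subset_foldl_adjoin[of "adjoin Q z"] by auto
  then show ?case
    using Cons ideal_set_adjoin by auto
qed simp

text \<open>The \<open>g i\<close> are the values of a cochain of degree t =
  \<open>length ys\<close> on the facets of the simplex with vertices \<open>ys @ [w]\<close>, where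
  \<open>g i\<close> belongs to the facet omitting vertex i. The syzygy makes it closed on the
  simplex, and annihilation by \<open>zs\<close> makes it closed elsewhere. A sequence longer than t
  would make it a coboundary; but on the facet \<open>ys\<close> a coboundary has its value in the
  ideal of \<open>Q\<close> and \<open>ys\<close>, which \<open>nontrivial\<close> excludes.\<close>

lemma regular_on_length_le:
  assumes Q: "ideal_set Q" and fs: "set fs \<subseteq> A" "regular_on Q fs"
    and ys: "set ys \<subseteq> A" "w \<in> A" "set zs \<subseteq> A"
    and radical: "\<And>f. f \<in> set fs \<Longrightarrow> \<exists>e. f ^ e \<in> foldl adjoin Q (ys @ w # zs)"
    and g: "\<And>i. g i \<in> A" "\<And>z i. z \<in> set zs \<Longrightarrow> z * g i \<in> Q"
    and syzygy: "(\<Sum>i<length ys. (-1) ^ i * ys ! i * g i) + (-1) ^ length ys * w * g (length ys) \<in> Q"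
    and nontrivial: "g (length ys) \<notin> foldl adjoin Q ys"
  shows "length fs \<le> length ys"
proof (rule ccontr)
  assume "\<not> length fs \<le> length ys"
  define t where "t = length ys"
  \<comment> \<open>\<open>u i\<close> encodes the facet omitting vertex i, and \<open>F\<close> the
    absence of all elements of \<open>zs\<close>. The facets are distinct, so at most one summand of
    \<open>c\<close> is nonzero at a given list.\<close>
  define u where "u i = (replicate (Suc t) True)[i := False]" for i
  define F where "F = replicate (length zs) False"
  define c where "c l = (\<Sum>i\<le>t. if l = u i @ F then g i else 0)" for l
  let ?ys = "ys @ [w]"
  have len_u: "length (u i) = Suc t" for i
    unfolding u_def by (simp only: length_list_update length_replicate)
  have u_inj: "u i = u j \<longleftrightarrow> i = j" if "i \<le> t" "j \<le> t" for i j
  proof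
    assume "u i = u j"
    then have "u i ! i = u j ! i"
      by (rule arg_cong)
    moreover have "u k ! i \<longleftrightarrow> k \<noteq> i" for k
      unfolding u_def using that(1) by (cases "k = i") (auto simp del: replicate_Suc)
    ultimately show "i = j"
      by blast
  qed simp
  have count_u: "count_list (u i) True = t" if "i \<le> t" for i
  proof -
    have "count_list ((replicate (Suc m) True)[i := False]) True = m" if "i \<le> m" for m
      using that
    proof (induction m arbitrary: i)
      case (Suc m)
      have rep: "count_list (replicate k True) True = k" for k
        by (induction k) auto
      show ?case
        using Suc rep[of m] by (cases i) auto
    qed simp
    then show ?thesis
      using that by (simp add: u_def)
  qed
  have count_F: "count_list F True = 0"
    unfolding F_def by (induction zs) auto
  have c_u: "c (u i @ F) = g i" if "i \<le> t" for i
  proof -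
    have "c (u i @ F) = (\<Sum>j\<le>t. if j = i then g j else 0)"
      unfolding c_def using u_inj that by (intro sum.cong) auto
    then show ?thesis
      using that by simp
  qed
  have c_mem: "c l \<in> A" for l
    unfolding c_def using g zero_mem by (intro sum_mem) auto
  have c_weight: "count_list l True = t" if "c l \<noteq> 0" for l
  proof -
    have "\<exists>i\<le>t. l = u i @ F"
    proof (rule ccontr)
      assume "\<not> (\<exists>i\<le>t. l = u i @ F)"
      then have "c l = 0"
        unfolding c_def by (intro sum.neutral) auto
      then show False
        using that by simp
    qed
    then show ?thesis
      using count_u count_F by auto
  qed
  have cocycle: "koszul (?ys @ zs) c l \<in> Q" if l: "length l = length (?ys @ zs)" for l
  proof -
    define l1 l2 where "l1 = take (Suc t) l" "l2 = drop (Suc t) l"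
    have l12: "l = l1 @ l2" "length l1 = Suc t" "length l2 = length zs"
      using l by (auto simp: l1_l2_def t_def)
    have "koszul zs (\<lambda>l'. c (l1 @ l')) l2 \<in> Q"
    proof (rule koszul_annihilated[OF Q])
      fix z l' assume "z \<in> set zs"
      then show "z * c (l1 @ l') \<in> Q"
        unfolding c_def sum_distrib_left
        using g(2) ideal_setD(2)[OF Q] by (intro ideal_set_sum[OF Q]) auto
    qed
    then have "(-1) ^ count_list l1 True * koszul zs (\<lambda>l'. c (l1 @ l')) l2 \<in> Q"
      by (intro ideal_setD(4)[OF Q] power_mem uminus_mem one_mem)
    moreover have "koszul ?ys (\<lambda>l. c (l @ l2)) l1 \<in> Q"
    proof (cases "koszul ?ys (\<lambda>l. c (l @ l2)) l1 = 0")
      case True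
      then show ?thesis
        using ideal_setD(2)[OF Q] by simp
    next
      case nz: False
      have l2: "l2 = F"
      proof (rule ccontr)
        assume "l2 \<noteq> F"
        then have "c (l @ l2) = 0" if "length l = Suc t" for l
          unfolding c_def using that len_u by (intro sum.neutral) auto
        \<comment> \<open>Membership in the zero ideal of the whole ring expresses that the
          differential depends only on values at lists of the right length.\<close>
        then have "koszul ?ys (\<lambda>l. c (l @ l2)) l1 \<in> {0}"
          using l12(2) uminus_mem by (intro subring_set.koszul_mem[of UNIV])
            (auto simp: subring_set_def subring_set.ideal_set_def t_def)
        then show False
          using nz by simp
      qed
      \<comment> \<open>By degree, only the full simplex can carry a nonzero coboundary along
        \<open>ys @ [w]\<close>, and there its value is the syzygy.\<close>
      have "count_list l1 True = Suc t"
        using nz c_weight l2 count_F by (intro koszul_weight[of "\<lambda>l. c (l @ l2)" _ ?ys]) fastforce+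
      then have "l1 = replicate (length ?ys) True"
      proof -
        have "l = replicate (length l) True" if "count_list l True = length l" for l
          using that
        proof (induction l)
          case (Cons b l)
          have "count_list l True \<le> length l"
            by (rule count_le_length)
          then show ?case
            using Cons by (cases b) auto
        qed simp
        from this[of l1] show ?thesis
          using \<open>count_list l1 True = Suc t\<close> l12(2) by (simp add: t_def)
      qed
      then have "koszul ?ys (\<lambda>l. c (l @ l2)) l1 = (\<Sum>i<length ?ys. (-1) ^ i * ?ys ! i * c (u i @ F))"
        unfolding u_def t_def l2 using koszul_replicate_True[of ?ys "\<lambda>l. c (l @ F)"]
        by (simp del: sum.lessThan_Suc replicate_Suc)
      also have "\<dots> = (\<Sum>i<length ?ys. (-1) ^ i * ?ys ! i * g i)"
        by (intro sum.cong) (auto simp: c_u t_def)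
      also have "\<dots> = (\<Sum>i<length ys. (-1) ^ i * ys ! i * g i) + (-1) ^ length ys * w * g (length ys)"
        by (simp add: nth_append)
      finally show ?thesis
        using syzygy by simp
    qed
    ultimately show ?thesis
      unfolding l12(1) using ideal_setD(3)[OF Q] l12(2) by (subst koszul_append) (auto simp: t_def)
  qed
  have "\<exists>b. (\<forall>l. b l \<in> A) \<and> (\<forall>l. b l \<noteq> 0 \<longrightarrow> Suc (count_list l True) = t) \<and>
    (\<forall>l. length l = length (?ys @ zs) \<longrightarrow> c l - koszul (?ys @ zs) b l \<in> Q)"
  proof (rule koszul_exact[OF Q _ fs])
    show "t < length fs"
      using \<open>\<not> length fs \<le> length ys\<close> by (simp add: t_def)
    fix f assume "f \<in> set fs"
    then obtain e where "f ^ e \<in> foldl adjoin Q (?ys @ zs)"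
      using radical by force
    then obtain q a where a: "f ^ e = q + (\<Sum>i<length (?ys @ zs). (?ys @ zs) ! i * a i)" "q \<in> Q"
        "\<forall>i<length (?ys @ zs). a i \<in> A"
      using foldl_adjoin[OF Q, of "?ys @ zs"] ys by auto
    define as where "as = map a [0..<length (?ys @ zs)]"
    have "(\<Sum>i<length (?ys @ zs). as ! i * (?ys @ zs) ! i) = (\<Sum>i<length (?ys @ zs). (?ys @ zs) ! i * a i)"
      by (intro sum.cong) (auto simp: as_def simp del: upt_Suc)
    then show "\<exists>e as. length as = length (?ys @ zs) \<and> set as \<subseteq> A \<and>
      f ^ e - (\<Sum>i<length (?ys @ zs). as ! i * (?ys @ zs) ! i) \<in> Q"
      using a by (intro exI[of _ e] exI[of _ as]) (auto simp: as_def simp del: upt_Suc)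
  qed (use ys c_mem c_weight cocycle in auto)
  then obtain b where b: "\<And>l. b l \<in> A"
      "\<And>l. length l = length (?ys @ zs) \<Longrightarrow> c l - koszul (?ys @ zs) b l \<in> Q"
    by blast
  let ?I = "foldl adjoin Q ys"
  note I = ideal_setD[OF ideal_set_foldl_adjoin[OF Q ys(1)]]
  have "u t = replicate t True @ [False]"
  proof -
    have "replicate (Suc t) True = replicate t True @ [True]"
      by (simp add: replicate_append_same)
    then show ?thesis
      unfolding u_def by (simp add: list_update_append del: replicate_Suc)
  qed
  then have u_t: "u t @ F = replicate (length ys) True @ replicate (length (w # zs)) False"
    by (simp add: F_def t_def)
  \<comment> \<open>Neither w nor any element of \<open>zs\<close> occurs in this face, so only the
    differential along \<open>ys\<close> contributes.\<close>
  have "koszul (?ys @ zs) b (u t @ F) = koszul ys (\<lambda>l. b (l @ replicate (length (w # zs)) False)) (replicate (length ys) True)"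
    unfolding u_t using koszul_append[of "replicate (length ys) True" ys "w # zs" b]
      koszul_replicate_False[of zs] by simp
  also have "\<dots> \<in> ?I"
    using mem_foldl_adjoin[OF Q ys(1)] I(4) b(1)
    by (intro koszul_annihilated ideal_set_foldl_adjoin Q ys) (metis mult.commute)
  finally have "koszul (?ys @ zs) b (u t @ F) \<in> ?I" .
  moreover have "c (u t @ F) - koszul (?ys @ zs) b (u t @ F) \<in> ?I"
    using b(2)[of "u t @ F"] len_u subset_foldl_adjoin[of Q ys] by (auto simp: F_def t_def)
  ultimately have "c (u t @ F) \<in> ?I"
    using I(3) by fastforce
  then show False
    using nontrivial c_u[of t] by (simp add: t_def)
qed

end

section \<open>Polynomials and monomials\<close>

abbreviation (input) lookup :: "('a \<Rightarrow>\<^sub>0 'b::zero) \<Rightarrow> 'a \<Rightarrow> 'b" where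
  "lookup \<equiv> Poly_Mapping.lookup"

abbreviation (input) keys :: "('a \<Rightarrow>\<^sub>0 'b::zero) \<Rightarrow> 'a set" where
  "keys \<equiv> Poly_Mapping.keys"

abbreviation (input) single :: "'a \<Rightarrow> 'b \<Rightarrow> 'a \<Rightarrow>\<^sub>0 'b::zero" where
  "single \<equiv> Poly_Mapping.single"

lemma polys_in_iff: "p \<in> polys_in Z \<longleftrightarrow> (\<forall>m. lookup p m \<noteq> 0 \<longrightarrow> keys m \<subseteq> Z)"
  by (auto simp: polys_in_def in_keys_iff)

lemma keys_add_nat: "keys (a + b) = keys a \<union> keys (b :: 'a \<Rightarrow>\<^sub>0 nat)"
  by (auto simp: in_keys_iff lookup_add)

lemma subring_set_polys_in: "subring_set (polys_in Z :: 'k::field mpoly set)"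
proof
  show "1 \<in> (polys_in Z :: 'k mpoly set)"
    by (auto simp: polys_in_iff lookup_one when_def)
  fix x y :: "'k mpoly" assume xy: "x \<in> polys_in Z" "y \<in> polys_in Z"
  show "x - y \<in> polys_in Z"
    unfolding polys_in_iff
  proof (intro allI impI)
    fix m assume "lookup (x - y) m \<noteq> 0"
    then have "lookup x m \<noteq> 0 \<or> lookup y m \<noteq> 0"
      by (auto simp: lookup_minus)
    then show "keys m \<subseteq> Z"
      using xy by (auto simp: polys_in_iff)
  qed
  show "x * y \<in> polys_in Z"
    unfolding polys_in_def
  proof (intro CollectI ballI)
    fix m assume "m \<in> keys (x * y)"
    then obtain a b where "m = a + b" "a \<in> keys x" "b \<in> keys y"
      using keys_mult by blast
    then show "keys m \<subseteq> Z"
      using xy by (simp add: polys_in_def keys_add_nat)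
  qed
qed

lemma poly_mapping_sum_single: "(\<Sum>m\<in>keys p. single m (lookup p m)) = p"
proof (rule poly_mapping_eqI)
  fix k
  have "lookup (\<Sum>m\<in>keys p. single m (lookup p m)) k = (\<Sum>m\<in>keys p. if m = k then lookup p m else 0)"
    unfolding lookup_sum by (intro sum.cong) (auto simp: lookup_single when_def)
  then show "lookup (\<Sum>m\<in>keys p. single m (lookup p m)) k = lookup p k"
    by (simp add: in_keys_iff)
qed

lemma times_single_eq:
  fixes p :: "'k::field mpoly"
  shows "p * single a 1 = (\<Sum>m\<in>keys p. single (m + a) (lookup p m))"
proof -
  have "p * single a 1 = (\<Sum>m\<in>keys p. single m (lookup p m)) * single a 1"
    by (simp only: poly_mapping_sum_single)
  then show ?thesis
    by (simp add: sum_distrib_right mult_single)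
qed

lemma lookup_times_single:
  fixes p :: "'k::field mpoly"
  shows "lookup (p * single a 1) (m + a) = lookup p m"
proof -
  have "lookup (p * single a 1) (m + a) = (\<Sum>k\<in>keys p. if k = m then lookup p k else 0)"
    unfolding times_single_eq lookup_sum by (intro sum.cong) (auto simp: lookup_single when_def)
  then show ?thesis
    by (simp add: in_keys_iff)
qed

lemma keys_times_single:
  fixes p :: "'k::field mpoly"
  shows "keys (p * single a 1) \<subseteq> (\<lambda>m. m + a) ` keys p"
  using keys_mult[of p "single a (1 :: 'k)"] by auto

definition indicator_exp :: "nat set \<Rightarrow> (nat \<Rightarrow>\<^sub>0 nat)" where
  "indicator_exp F = (\<Sum>i\<in>F. single i 1)"

definition sqfree_mon :: "nat set \<Rightarrow> 'k::field mpoly" where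
  "sqfree_mon F = single (indicator_exp F) 1"

lemma lookup_indicator_exp: "finite F \<Longrightarrow> lookup (indicator_exp F) i = (if i \<in> F then 1 else 0)"
  unfolding indicator_exp_def lookup_sum by (simp add: lookup_single when_def)

lemma keys_indicator_exp: "finite F \<Longrightarrow> keys (indicator_exp F) = F"
  by (auto simp: in_keys_iff lookup_indicator_exp split: if_splits)

lemma indicator_exp_insert:
  "finite F \<Longrightarrow> i \<notin> F \<Longrightarrow> indicator_exp (insert i F) = single i 1 + indicator_exp F"
  by (simp add: indicator_exp_def)

lemma sqfree_mon_insert:
  "finite F \<Longrightarrow> i \<notin> F \<Longrightarrow> sqfree_mon (insert i F) = var i * sqfree_mon F"
  by (simp add: sqfree_mon_def var_def indicator_exp_insert mult_single)

lemma sqfree_mon_mem: "finite F \<Longrightarrow> F \<subseteq> Z \<Longrightarrow> sqfree_mon F \<in> polys_in Z"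
  by (auto simp: polys_in_def sqfree_mon_def keys_indicator_exp)

lemma var_mem: "i \<in> Z \<Longrightarrow> var i \<in> polys_in Z"
  by (auto simp: polys_in_def var_def)

text \<open>Subtraction of exponents is truncated; it is exact here because a monomial whose support
  contains F is divisible by x_F.\<close>

lemma minus_indicator_exp:
  assumes "finite F" "F \<subseteq> keys m"
  shows "(m - indicator_exp F) + indicator_exp F = m"
proof (rule poly_mapping_eqI)
  fix i
  have "i \<in> F \<Longrightarrow> lookup m i \<noteq> 0"
    using assms(2) by (auto simp: in_keys_iff)
  then show "lookup (m - indicator_exp F + indicator_exp F) i = lookup m i"
    by (simp add: lookup_add lookup_minus lookup_indicator_exp assms(1))
qed

definition restrict_poly :: "('a \<Rightarrow> bool) \<Rightarrow> ('a \<Rightarrow>\<^sub>0 'b::comm_monoid_add) \<Rightarrow> 'a \<Rightarrow>\<^sub>0 'b" where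
  "restrict_poly P p = (\<Sum>m | m \<in> keys p \<and> P m. single m (lookup p m))"

lemma lookup_restrict_poly: "lookup (restrict_poly P p) k = (if P k then lookup p k else 0)"
proof -
  have "lookup (restrict_poly P p) k
      = (\<Sum>m | m \<in> keys p \<and> P m. if m = k then lookup p m else 0)"
    unfolding restrict_poly_def lookup_sum by (intro sum.cong) (auto simp: lookup_single when_def)
  then show ?thesis
    by (simp add: in_keys_iff)
qed

definition box_polys :: "nat set \<Rightarrow> nat set \<Rightarrow> 'k::field mpoly set" where
  "box_polys E F = {p. \<forall>m. lookup p m \<noteq> 0 \<longrightarrow> E \<subseteq> keys m \<and> keys m \<subseteq> F}"

text \<open>Multiplication by x_E enlarges each support by E, and conversely x_E divides every
  monomial whose support contains E. Intervals of supports thus correspond to Stanley spaces x_E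
  K[F].\<close>

lemma box_polys_eq:
  assumes "finite E" "E \<subseteq> F"
  shows "box_polys E F = (\<lambda>u. u * sqfree_mon E) ` (polys_in F :: 'k::field mpoly set)"
proof (intro equalityI subsetI)
  fix p :: "'k mpoly" assume p: "p \<in> box_polys E F"
  define u :: "'k mpoly" where "u = (\<Sum>m\<in>keys p. single (m - indicator_exp E) (lookup p m))"
  have "u * sqfree_mon E = (\<Sum>m\<in>keys p. single m (lookup p m))"
    unfolding u_def sqfree_mon_def sum_distrib_right mult_single
    using p assms by (intro sum.cong refl) (auto simp: minus_indicator_exp box_polys_def in_keys_iff)
  then have "p = u * sqfree_mon E"
    by (simp add: poly_mapping_sum_single)
  moreover have "u \<in> polys_in F"
    unfolding u_def
  proof (rule subring_set.sum_mem[OF subring_set_polys_in])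
    fix m assume "m \<in> keys p"
    then have "keys m \<subseteq> F"
      using p by (auto simp: box_polys_def in_keys_iff)
    moreover have "keys (m - indicator_exp E) \<subseteq> keys m"
      by (auto simp: in_keys_iff lookup_minus)
    ultimately show "single (m - indicator_exp E) (lookup p m) \<in> polys_in F"
      by (auto simp: polys_in_def)
  qed
  ultimately show "p \<in> (\<lambda>u. u * sqfree_mon E) ` polys_in F"
    by blast
next
  fix p :: "'k mpoly" assume "p \<in> (\<lambda>u. u * sqfree_mon E) ` polys_in F"
  then obtain u where u: "p = u * sqfree_mon E" "u \<in> polys_in F"
    by blast
  show "p \<in> box_polys E F"
    unfolding box_polys_def
  proof (intro CollectI allI impI)
    fix m assume "lookup p m \<noteq> 0"
    then have "m \<in> keys (u * sqfree_mon E)"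
      using u by (simp add: in_keys_iff)
    then obtain k where "k \<in> keys u" "m = k + indicator_exp E"
      using keys_times_single unfolding sqfree_mon_def by blast
    then show "E \<subseteq> keys m \<and> keys m \<subseteq> F"
      using u(2) assms by (auto simp: keys_add_nat keys_indicator_exp polys_in_def)
  qed
qed

declare One_nat_def [simp del]

section \<open>Quotients of the polynomial ring\<close>

lemma poly_ring_simps [simp]:
  "carrier (poly_ring n) = polys_in {1..n}" "mult (poly_ring n) = (*)" "one (poly_ring n) = 1"
  "zero (poly_ring n) = 0" "add (poly_ring n) = (+)"
  by (simp_all add: poly_ring_def)

lemma cring_poly_ring: "cring (poly_ring n :: 'k::field mpoly ring)"
proof -
  interpret subring_set "polys_in {1..n} :: 'k mpoly set"
    by (rule subring_set_polys_in)
  show ?thesis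
  proof (intro cringI abelian_groupI comm_monoidI)
    fix x :: "'k mpoly" assume "x \<in> carrier (poly_ring n)"
    then show "\<exists>y\<in>carrier (poly_ring n). y \<oplus>\<^bsub>poly_ring n\<^esub> x = \<zero>\<^bsub>poly_ring n\<^esub>"
      using uminus_mem by (intro bexI[of _ "- x"]) auto
  qed (auto simp: one_mem zero_mem add_mem mult_mem algebra_simps)
qed

text \<open>This connects the ideals in the statement of the theorem with the arithmetic on subsets
  of the type.\<close>

lemma ideal_poly_ring_iff:
  "ideal I (poly_ring n) \<longleftrightarrow> subring_set.ideal_set (polys_in {1..n}) (I :: 'k::field mpoly set)"
proof -
  interpret subring_set "polys_in {1..n} :: 'k mpoly set"
    by (rule subring_set_polys_in)
  interpret R: cring "poly_ring n :: 'k mpoly ring"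
    by (rule cring_poly_ring)
  show ?thesis
  proof
    assume "ideal I (poly_ring n)"
    then interpret I: ideal I "poly_ring n" .
    show "ideal_set I"
      unfolding ideal_set_def
      using I.a_subset I.zero_closed I.a_closed I.I_l_closed by auto
  next
    assume I: "ideal_set I"
    have inv: "\<ominus>\<^bsub>poly_ring n\<^esub> x = - x" if "x \<in> polys_in {1..n}" for x :: "'k mpoly"
      using that uminus_mem by (intro R.minus_equality) auto
    show "ideal I (poly_ring n)"
    proof (rule idealI)
      show "subgroup I (add_monoid (poly_ring n))"
        using ideal_setD[OF I] by (intro R.add.subgroupI) (auto simp: inv simp flip: a_inv_def)
    qed (use ideal_setD[OF I] R.ring_axioms in \<open>auto simp: mult.commute\<close>)
  qed
qed

locale poly_quotient =
  fixes n :: nat and J :: "'k::field mpoly set"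
  assumes ideal: "subring_set.ideal_set (polys_in {1..n}) J"
begin

sublocale subring_set "polys_in {1..n} :: 'k mpoly set"
  by (rule subring_set_polys_in)

sublocale J: ideal J "poly_ring n"
  using ideal ideal_poly_ring_iff by blast

abbreviation M where "M \<equiv> quot_module (poly_ring n) J"

abbreviation coset where "coset \<equiv> a_r_coset (poly_ring n) J"

lemma coset_eq: "coset p = (\<lambda>q. q + p) ` J"
  by (auto simp: a_r_coset_def r_coset_def)

lemma coset_eq_iff: "coset p = coset q \<longleftrightarrow> p - q \<in> J"
proof
  assume "coset p = coset q"
  then have "0 + p \<in> coset q"
    using ideal_setD(2)[OF ideal] unfolding coset_eq by blast
  then show "p - q \<in> J"
    unfolding coset_eq by auto
next
  have sub: "coset p \<subseteq> coset q" if "p - q \<in> J" for p q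
    unfolding coset_eq
  proof (rule image_subsetI)
    fix r assume "r \<in> J"
    then have "r + (p - q) \<in> J"
      using that ideal_setD(3)[OF ideal] by blast
    moreover have "r + p = (r + (p - q)) + q"
      by simp
    ultimately show "r + p \<in> (\<lambda>r. r + q) ` J"
      by blast
  qed
  assume "p - q \<in> J"
  then show "coset p = coset q"
    using sub[of p q] sub[of q p] ideal_setD(5)[OF ideal, of "p - q"] by auto
qed

lemma M_simps [simp]:
  "carrier M = coset ` polys_in {1..n}" "zero M = coset 0" "one M = coset 1"
  "p \<in> polys_in {1..n} \<Longrightarrow> q \<in> polys_in {1..n} \<Longrightarrow> add M (coset p) (coset q) = coset (p + q)"
  "p \<in> polys_in {1..n} \<Longrightarrow> q \<in> polys_in {1..n} \<Longrightarrow> smult M p (coset q) = coset (p * q)"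
proof -
  have "carrier M = coset ` carrier (poly_ring n)"
    by (auto simp: quot_module_def FactRing_def A_RCOSETS_defs a_r_coset_def)
  then show "carrier M = coset ` polys_in {1..n}"
    by simp
  show "zero M = coset 0" "one M = coset 1"
    by (auto simp: quot_module_def FactRing_simps coset_eq)
qed (auto simp: quot_module_def FactRing_simps J.a_rcos_sum J.rcoset_mult_add)

lemma abelian_group_M: "abelian_group M"
proof (rule abelian_groupI)
  fix X assume "X \<in> carrier M"
  then obtain p where p: "X = coset p" "p \<in> polys_in {1..n}"
    by auto
  then show "\<exists>Y\<in>carrier M. Y \<oplus>\<^bsub>M\<^esub> X = \<zero>\<^bsub>M\<^esub>"
    using uminus_mem by (intro bexI[of _ "coset (- p)"]) auto
qed (auto simp: zero_mem add_mem algebra_simps)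

sublocale M: abelian_group M
  by (rule abelian_group_M)

lemma finsum_coset:
  assumes "finite I" "\<And>i. i \<in> I \<Longrightarrow> q i \<in> polys_in {1..n}"
  shows "finsum M (\<lambda>i. coset (q i)) I = coset (\<Sum>i\<in>I. q i)"
  using assms
proof (induction I rule: finite_induct)
  case (insert i I)
  then have "finsum M (\<lambda>i. coset (q i)) (insert i I) = add M (coset (q i)) (finsum M (\<lambda>i. coset (q i)) I)"
    by (intro M.finsum_insert) auto
  then show ?case
    using insert sum_mem[of I q] by simp
qed simp

lemma uminus_coset: "p \<in> polys_in {1..n} \<Longrightarrow> \<ominus>\<^bsub>M\<^esub> coset p = coset (- p)"
  using uminus_mem by (intro M.minus_equality) auto

lemma stanley_space_eq:
  assumes "E \<subseteq> F" "F \<subseteq> {1..n}"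
  shows "stanley_space M (coset (sqfree_mon E)) F = coset ` box_polys E F"
proof -
  have "finite E" "sqfree_mon E \<in> (polys_in {1..n} :: 'k mpoly set)"
    using assms finite_subset[of E "{1..n}"] by (auto intro: sqfree_mon_mem)
  moreover have "u \<in> polys_in {1..n}" if "u \<in> polys_in F" for u :: "'k mpoly"
    using that assms(2) by (auto simp: polys_in_def)
  ultimately show ?thesis
    unfolding stanley_space_def box_polys_eq[OF \<open>finite E\<close> assms(1)] image_image
    by (intro image_cong) auto
qed

end

lemma (in poly_quotient) additive_subgroup_box:
  assumes "F \<subseteq> {1..n}"
  shows "additive_subgroup (coset ` box_polys E F) M"
proof (rule additive_subgroup.intro, rule M.add.subgroupI)
  have box: "p \<in> polys_in {1..n}" if "p \<in> box_polys E F" for p :: "'k mpoly"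
    using that assms by (auto simp: box_polys_def polys_in_iff)
  show "coset ` box_polys E F \<subseteq> carrier M"
    using box by auto
  have "0 \<in> box_polys E F"
    by (simp add: box_polys_def)
  then show "coset ` box_polys E F \<noteq> {}"
    by blast
  fix X assume "X \<in> coset ` box_polys E F"
  then obtain p where p: "X = coset p" "p \<in> box_polys E F"
    by blast
  have "- p \<in> box_polys E F"
    using p(2) by (simp add: box_polys_def)
  then show "\<ominus>\<^bsub>M\<^esub> X \<in> coset ` box_polys E F"
    using p uminus_coset box by simp
  fix Y assume "Y \<in> coset ` box_polys E F"
  then obtain q where q: "Y = coset q" "q \<in> box_polys E F"
    by blast
  have "p + q \<in> box_polys E F"
    unfolding box_polys_def
  proof (intro CollectI allI impI)
    fix m assume "lookup (p + q) m \<noteq> 0"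
    then have "lookup p m \<noteq> 0 \<or> lookup q m \<noteq> 0"
      by (auto simp: lookup_add)
    then show "E \<subseteq> keys m \<and> keys m \<subseteq> F"
      using p(2) q(2) unfolding box_polys_def by blast
  qed
  then show "X \<oplus>\<^bsub>M\<^esub> Y \<in> coset ` box_polys E F"
    using p q box by auto
qed

section \<open>Stanley decompositions from interval partitions\<close>

text \<open>For a simplicial complex \<Delta> this is the Stanley-Reisner ideal, described by
  coefficients instead of generators, so that membership is decided monomial by monomial.\<close>

definition nonface_polys :: "nat \<Rightarrow> nat set set \<Rightarrow> 'k::field mpoly set" where
  "nonface_polys n \<Delta> = {p \<in> polys_in {1..n}. \<forall>m. keys m \<in> \<Delta> \<longrightarrow> lookup p m = 0}"

text \<open>Counting list positions excludes repeated intervals as well: the value 1 expresses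
  covering and disjointness, the value 0 that no interval leaves \<Delta>.\<close>

definition interval_partition :: "nat set set \<Rightarrow> (nat set \<times> nat set) list \<Rightarrow> bool" where
  "interval_partition \<Delta> L \<longleftrightarrow> (\<forall>(E, F)\<in>set L. E \<subseteq> F) \<and>
    (\<forall>G. length (filter (\<lambda>(E, F). E \<subseteq> G \<and> G \<subseteq> F) L) = (if G \<in> \<Delta> then 1 else 0))"

text \<open>The monomials with support in \<Delta> form a K-basis of the quotient, and the support
  of each lies in exactly one interval. This distributes the basis among the Stanley spaces.\<close>

lemma (in poly_quotient) stanley_decomposition_interval_partition:
  assumes J: "J = nonface_polys n \<Delta>" and L: "interval_partition \<Delta> L"
    and \<Delta>: "\<And>G. G \<in> \<Delta> \<Longrightarrow> G \<subseteq> {1..n}"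
  shows "stanley_decomposition n M (quot_component n J) (map (\<lambda>(E, F). (coset (sqfree_mon E), F)) L)"
proof -
  define E where "E i = fst (L ! i)" for i
  define F where "F i = snd (L ! i)" for i
  note E_F_def = E_def F_def
  define N where "N = length L"
  have EF: "E i \<subseteq> F i" if "i < N" for i
    using L nth_mem[of i L] that unfolding interval_partition_def E_F_def N_def by fastforce
  have card: "card {i. i < N \<and> E i \<subseteq> G \<and> G \<subseteq> F i} = (if G \<in> \<Delta> then 1 else 0)" for G
    using L unfolding interval_partition_def length_filter_conv_card E_F_def N_def
    by (simp add: case_prod_beta)
  have mem_\<Delta>: "G \<in> \<Delta>" if "i < N" "E i \<subseteq> G" "G \<subseteq> F i" for i G
  proof (rule ccontr)
    assume "G \<notin> \<Delta>"
    then have "{i. i < N \<and> E i \<subseteq> G \<and> G \<subseteq> F i} = {}"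
      using card[of G] by simp
    then show False
      using that by blast
  qed
  have unique: "i = j" if "i < N" "E i \<subseteq> G" "G \<subseteq> F i" "j < N" "E j \<subseteq> G" "G \<subseteq> F j" for i j G
  proof -
    have "card {i. i < N \<and> E i \<subseteq> G \<and> G \<subseteq> F i} = 1"
      using card[of G] mem_\<Delta>[OF that(1-3)] by simp
    then obtain x where x: "{i. i < N \<and> E i \<subseteq> G \<and> G \<subseteq> F i} = {x}"
      by (rule card_1_singletonE)
    have "i \<in> {x}" "j \<in> {x}"
      using that unfolding x[symmetric] by simp_all
    then show ?thesis
      by simp
  qed
  have exists: "\<exists>i<N. E i \<subseteq> G \<and> G \<subseteq> F i" if "G \<in> \<Delta>" for G
  proof -
    have "card {i. i < N \<and> E i \<subseteq> G \<and> G \<subseteq> F i} = 1"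
      using card[of G] that by simp
    then have "{i. i < N \<and> E i \<subseteq> G \<and> G \<subseteq> F i} \<noteq> {}"
      by (intro notI) simp
    then show ?thesis
      by auto
  qed
  have Fn: "F i \<subseteq> {1..n}" if "i < N" for i
    using mem_\<Delta>[OF that EF] that \<Delta> by blast
  have box: "p \<in> polys_in {1..n}" if "i < N" "p \<in> box_polys (E i) (F i)" for i and p :: "'k mpoly"
    using that Fn by (fastforce simp: box_polys_def polys_in_iff)
  have J_box: "p = 0" if "i < N" "p \<in> box_polys (E i) (F i)" "p \<in> J" for i p
  proof (rule poly_mapping_eqI)
    fix m
    show "lookup p m = lookup 0 m"
      using that mem_\<Delta>[of i "keys m"] unfolding J nonface_polys_def box_polys_def by fastforce
  qed
  let ?D = "map (\<lambda>(E, F). (coset (sqfree_mon E), F)) L"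
  have D: "?D ! i = (coset (sqfree_mon (E i)), F i)" if "i < N" for i
    using that by (simp add: E_F_def N_def case_prod_beta)
  have free: "stanley_free M (coset (sqfree_mon (E i))) (F i)" if i: "i < N" for i
    unfolding stanley_free_def
  proof (intro ballI impI)
    fix u :: "'k mpoly"
    assume u: "u \<in> polys_in (F i)" "u \<odot>\<^bsub>M\<^esub> coset (sqfree_mon (E i)) = \<zero>\<^bsub>M\<^esub>"
    have "finite (E i)"
      using EF Fn i finite_subset[of "E i" "{1..n}"] by blast
    have "u \<in> polys_in {1..n}"
      using u Fn[OF i] by (auto simp: polys_in_def)
    moreover have "sqfree_mon (E i) \<in> (polys_in {1..n} :: 'k mpoly set)"
      using Fn[OF i] EF[OF i] \<open>finite (E i)\<close> by (intro sqfree_mon_mem) auto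
    ultimately have "coset (u * sqfree_mon (E i)) = coset 0"
      using u(2) by simp
    then have uJ: "u * sqfree_mon (E i) \<in> J"
      by (simp add: coset_eq_iff)
    have "u * sqfree_mon (E i) \<in> box_polys (E i) (F i)"
      using box_polys_eq[OF \<open>finite (E i)\<close> EF[OF i]] u(1) by blast
    then have "u * sqfree_mon (E i) = 0"
      using J_box i uJ by blast
    show "u = 0"
    proof (rule poly_mapping_eqI)
      fix m
      have "lookup u m = lookup (u * sqfree_mon (E i)) (m + indicator_exp (E i))"
        by (simp only: sqfree_mon_def lookup_times_single)
      then show "lookup u m = lookup 0 m"
        by (simp only: \<open>u * sqfree_mon (E i) = 0\<close> lookup_zero)
    qed
  qed
  have homogeneous: "homogeneous_element n (quot_component n J) (coset (sqfree_mon (E i)))" if i: "i < N" for i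
  proof -
    have fin: "finite (E i)" and sub: "E i \<subseteq> {1..n}"
      using EF Fn i finite_subset[of "E i" "{1..n}"] by blast+
    let ?a = "Poly_Mapping.map int (indicator_exp (E i))"
    have "keys ?a \<subseteq> keys (indicator_exp (E i))"
      by (auto simp: in_keys_iff Poly_Mapping.map.rep_eq when_def split: if_splits)
    then have "?a \<in> multidegrees n"
      using fin sub by (simp add: multidegrees_def keys_indicator_exp)
    moreover have "sqfree_mon (E i) \<in> poly_component n ?a"
      using sqfree_mon_mem[OF fin sub] by (auto simp: poly_component_def sqfree_mon_def)
    ultimately show ?thesis
      unfolding homogeneous_element_def quot_component_def by blast
  qed
  have space: "stanley_space M (fst (?D ! i)) (snd (?D ! i)) = coset ` box_polys (E i) (F i)" if "i < N" for i
    using stanley_space_eq EF Fn D that by simp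
  have direct: "internal_direct_sum M {..<N} (\<lambda>i. coset ` box_polys (E i) (F i))"
    unfolding internal_direct_sum_def
  proof (intro conjI ballI)
    show "additive_subgroup (coset ` box_polys (E i) (F i)) M" if "i \<in> {..<N}" for i
      using that Fn by (intro additive_subgroup_box) auto
    fix v assume "v \<in> carrier M"
    then obtain p where p: "v = coset p" "p \<in> polys_in {1..n}"
      by auto
    \<comment> \<open>\<open>r i\<close> collects the monomials of p that belong to interval i;
      those in no interval have a nonface as support and vanish in the quotient.\<close>
    define r where "r i = restrict_poly (\<lambda>m. E i \<subseteq> keys m \<and> keys m \<subseteq> F i) p" for i
    have r: "r i \<in> box_polys (E i) (F i)" for i
      by (auto simp: r_def box_polys_def lookup_restrict_poly)
    have sum_r: "p - (\<Sum>i<N. r i) \<in> J"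
      unfolding J nonface_polys_def
    proof (intro CollectI conjI allI impI)
      show "p - (\<Sum>i<N. r i) \<in> polys_in {1..n}"
        using p box r by (intro diff_mem sum_mem) auto
      fix m :: "nat \<Rightarrow>\<^sub>0 nat" assume "keys m \<in> \<Delta>"
      then obtain i where i: "i < N" "E i \<subseteq> keys m" "keys m \<subseteq> F i"
        using exists by blast
      have "lookup (r j) m = (if j = i then lookup p m else 0)" if "j < N" for j
      proof (cases "j = i")
        case False
        then have "\<not> (E j \<subseteq> keys m \<and> keys m \<subseteq> F j)"
          using unique[OF i that] by blast
        then show ?thesis
          using False by (auto simp: r_def lookup_restrict_poly)
      qed (use i in \<open>simp add: r_def lookup_restrict_poly\<close>)
      then have "(\<Sum>j<N. lookup (r j) m) = (\<Sum>j<N. if j = i then lookup p m else 0)"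
        by (intro sum.cong) auto
      then show "lookup (p - (\<Sum>i<N. r i)) m = 0"
        using i by (simp add: lookup_minus lookup_sum)
    qed
    \<comment> \<open>The direct sum is formed over the indices with nonzero value. A box meets
      \<open>J\<close> only in 0, so the omitted summands are zero already as polynomials.\<close>
    have decomposes: "finsum M (\<lambda>i. coset (q i)) {i \<in> {..<N}. coset (q i) \<noteq> \<zero>\<^bsub>M\<^esub>} = coset (\<Sum>i<N. q i)"
      if q: "\<And>i. i < N \<Longrightarrow> q i \<in> box_polys (E i) (F i)" for q :: "nat \<Rightarrow> 'k mpoly"
    proof -
      have "q i = 0" if "i < N" "coset (q i) = \<zero>\<^bsub>M\<^esub>" for i
        using J_box[OF that(1) q[OF that(1)]] that(2) by (simp add: coset_eq_iff)
      then have "(\<Sum>i\<in>{i \<in> {..<N}. coset (q i) \<noteq> \<zero>\<^bsub>M\<^esub>}. q i) = (\<Sum>i<N. q i)"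
        by (intro sum.mono_neutral_left) auto
      moreover have "q i \<in> polys_in {1..n}" if "i \<in> {i \<in> {..<N}. coset (q i) \<noteq> \<zero>\<^bsub>M\<^esub>}" for i
        using that box q by blast
      ultimately show ?thesis
        using finsum_coset[of "{i \<in> {..<N}. coset (q i) \<noteq> \<zero>\<^bsub>M\<^esub>}" q] by simp
    qed
    show "\<exists>!f. f \<in> (\<Pi>\<^sub>E i\<in>{..<N}. coset ` box_polys (E i) (F i)) \<and>
        finite {i \<in> {..<N}. f i \<noteq> \<zero>\<^bsub>M\<^esub>} \<and> v = finsum M f {i \<in> {..<N}. f i \<noteq> \<zero>\<^bsub>M\<^esub>}"
    proof (rule ex1I[of _ "\<lambda>i\<in>{..<N}. coset (r i)"])
      let ?f = "\<lambda>i\<in>{..<N}. coset (r i)"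
      have S: "{i \<in> {..<N}. ?f i \<noteq> \<zero>\<^bsub>M\<^esub>} = {i \<in> {..<N}. coset (r i) \<noteq> \<zero>\<^bsub>M\<^esub>}"
        by auto
      have "finsum M ?f {i \<in> {..<N}. ?f i \<noteq> \<zero>\<^bsub>M\<^esub>}
          = finsum M (\<lambda>i. coset (r i)) {i \<in> {..<N}. coset (r i) \<noteq> \<zero>\<^bsub>M\<^esub>}"
        unfolding S using box r by (intro M.finsum_cong') auto
      also have "\<dots> = coset (\<Sum>i<N. r i)"
        using r by (intro decomposes)
      also have "\<dots> = v"
        using sum_r p(1) coset_eq_iff by blast
      finally show "?f \<in> (\<Pi>\<^sub>E i\<in>{..<N}. coset ` box_polys (E i) (F i)) \<and>
        finite {i \<in> {..<N}. ?f i \<noteq> \<zero>\<^bsub>M\<^esub>} \<and> v = finsum M ?f {i \<in> {..<N}. ?f i \<noteq> \<zero>\<^bsub>M\<^esub>}"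
        using r by simp
      fix f
      assume f: "f \<in> (\<Pi>\<^sub>E i\<in>{..<N}. coset ` box_polys (E i) (F i)) \<and>
        finite {i \<in> {..<N}. f i \<noteq> \<zero>\<^bsub>M\<^esub>} \<and> v = finsum M f {i \<in> {..<N}. f i \<noteq> \<zero>\<^bsub>M\<^esub>}"
      have "\<exists>q. q \<in> box_polys (E i) (F i) \<and> f i = coset q" if "i \<in> {..<N}" for i
        using PiE_mem[OF conjunct1[OF f] that] by blast
      then have "\<exists>q. \<forall>i\<in>{..<N}. q i \<in> box_polys (E i) (F i) \<and> f i = coset (q i)"
        by (intro bchoice) blast
      then obtain q where q: "\<And>i. i < N \<Longrightarrow> q i \<in> box_polys (E i) (F i)" "\<And>i. i < N \<Longrightarrow> f i = coset (q i)"
        by (meson lessThan_iff)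
      have S: "{i \<in> {..<N}. f i \<noteq> \<zero>\<^bsub>M\<^esub>} = {i \<in> {..<N}. coset (q i) \<noteq> \<zero>\<^bsub>M\<^esub>}"
        using q(2) by auto
      have "v = finsum M (\<lambda>i. coset (q i)) {i \<in> {..<N}. coset (q i) \<noteq> \<zero>\<^bsub>M\<^esub>}"
        unfolding conjunct2[OF conjunct2[OF f]] S using q box by (intro M.finsum_cong') auto
      also have "\<dots> = coset (\<Sum>i<N. q i)"
        using q by (intro decomposes)
      finally have pq: "p - (\<Sum>i<N. q i) \<in> J"
        using p(1) coset_eq_iff by simp
      have "q i = r i" if i: "i < N" for i
      proof (rule poly_mapping_eqI)
        fix m
        show "lookup (q i) m = lookup (r i) m"
        proof (cases "E i \<subseteq> keys m \<and> keys m \<subseteq> F i")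
          case True
          \<comment> \<open>Only box i contains monomials with this support, so the coefficient of p
            at m determines that of \<open>q i\<close>.\<close>
          have "lookup (q j) m = 0" if "j < N" "j \<noteq> i" for j
          proof -
            have "\<not> (E j \<subseteq> keys m \<and> keys m \<subseteq> F j)"
              using unique[OF i _ _ that(1)] True that(2) by blast
            then show ?thesis
              using q(1)[OF that(1)] unfolding box_polys_def by blast
          qed
          then have "(\<Sum>j<N. lookup (q j) m) = (\<Sum>j<N. if j = i then lookup (q i) m else 0)"
            by (intro sum.cong) auto
          moreover have "lookup (p - (\<Sum>i<N. q i)) m = 0"
            using pq mem_\<Delta>[of i "keys m"] i True by (simp add: J nonface_polys_def)
          ultimately show ?thesis
            using True i by (simp add: r_def lookup_restrict_poly lookup_minus lookup_sum)
        next
          case False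
          then show ?thesis
            using q(1)[OF i] by (auto simp: r_def lookup_restrict_poly box_polys_def)
        qed
      qed
      then show "f = ?f"
        using PiE_arb[OF conjunct1[OF f]] q(2) by (intro ext) (auto simp: restrict_def)
    qed
  qed
  show ?thesis
    unfolding stanley_decomposition_def
  proof (intro conjI)
    have "internal_direct_sum M {..<N} (\<lambda>i. stanley_space M (fst (?D ! i)) (snd (?D ! i)))"
    proof -
      have "(\<Pi>\<^sub>E i\<in>{..<N}. stanley_space M (fst (?D ! i)) (snd (?D ! i)))
        = (\<Pi>\<^sub>E i\<in>{..<N}. coset ` box_polys (E i) (F i))"
        using space by (intro PiE_cong) auto
      then show ?thesis
        using direct space unfolding internal_direct_sum_def by simp
    qed
    then show "internal_direct_sum M {..<length ?D} (\<lambda>i. stanley_space M (fst (?D ! i)) (snd (?D ! i)))"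
      by (simp add: N_def)
    show "\<forall>(v, Z)\<in>set ?D. v \<in> carrier M \<and> homogeneous_element n (quot_component n J) v \<and>
        Z \<subseteq> {1..n} \<and> stanley_free M v Z"
    proof
      fix d assume "d \<in> set ?D"
      then obtain i where i: "i < N" "d = (coset (sqfree_mon (E i)), F i)"
        using D unfolding in_set_conv_nth N_def by force
      have "coset (sqfree_mon (E i)) \<in> carrier M"
        using EF[OF i(1)] Fn[OF i(1)] finite_subset[of "E i" "{1..n}"]
        by (auto intro!: imageI sqfree_mon_mem)
      then show "case d of (v, Z) \<Rightarrow> v \<in> carrier M \<and> homogeneous_element n (quot_component n J) v \<and>
          Z \<subseteq> {1..n} \<and> stanley_free M v Z"
        using i homogeneous free Fn by auto
    qed
  qed
qed

lemma interval_partitionD: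
  assumes "interval_partition \<Delta> L" "(E, F) \<in> set L"
  shows "E \<subseteq> F" "E \<subseteq> G \<Longrightarrow> G \<subseteq> F \<Longrightarrow> G \<in> \<Delta>"
proof -
  show "E \<subseteq> F"
    using assms unfolding interval_partition_def by blast
  show "G \<in> \<Delta>" if "E \<subseteq> G" "G \<subseteq> F"
  proof (rule ccontr)
    assume "G \<notin> \<Delta>"
    then have "filter (\<lambda>(E, F). E \<subseteq> G \<and> G \<subseteq> F) L = []"
      using assms(1)[unfolded interval_partition_def, THEN conjunct2, THEN spec, of G] by simp
    then show False
      using assms(2) that unfolding filter_empty_conv by blast
  qed
qed

lemma interval_partition_bounds:
  assumes "interval_partition \<Delta> L" "(E, F) \<in> set L"
  shows "E \<in> \<Delta>" "F \<in> \<Delta>"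
  using interval_partitionD[OF assms] by auto

lemma (in poly_quotient) sdepth_ge:
  assumes J: "J = nonface_polys n \<Delta>" and L: "interval_partition \<Delta> L"
    and \<Delta>: "\<And>G. G \<in> \<Delta> \<Longrightarrow> G \<subseteq> {1..n}" "{} \<in> \<Delta>"
    and d: "\<And>E F. (E, F) \<in> set L \<Longrightarrow> d \<le> card F"
  shows "d \<le> sdepth n M (quot_component n J)"
proof -
  let ?D = "map (\<lambda>(E, F). (coset (sqfree_mon E), F)) L"
  have D: "stanley_decomposition n M (quot_component n J) ?D"
    by (rule stanley_decomposition_interval_partition[OF J L \<Delta>(1)])
  have "L \<noteq> []"
    using L \<Delta>(2) unfolding interval_partition_def by (metis filter.simps(1) list.size(3) zero_neq_one)
  then have "d \<le> sdepth_decomposition ?D"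
    unfolding sdepth_decomposition_def using d by (subst Min_ge_iff) auto
  also have "\<dots> \<le> sdepth n M (quot_component n J)"
    unfolding sdepth_def
  proof (rule Max_ge)
    \<comment> \<open>A nonempty decomposition has value at most n. The empty list has the
      unspecified value \<open>Min {}\<close>, which is added to the bounding set to obtain
      finiteness for \<open>Max\<close>.\<close>
    have "sdepth_decomposition D' \<in> insert (sdepth_decomposition ([] :: ('k mpoly set \<times> nat set) list)) {..n}"
      if "stanley_decomposition n M (quot_component n J) D'" for D'
    proof (cases D')
      case (Cons vZ D'')
      have "snd vZ \<subseteq> {1..n}"
        using that Cons unfolding stanley_decomposition_def by auto
      then have "card (snd vZ) \<le> n"
        using card_mono[of "{1..n}"] by fastforce
      moreover have "sdepth_decomposition D' \<le> card (snd vZ)"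
        unfolding sdepth_decomposition_def using Cons by (intro Min_le) (auto simp: case_prod_beta)
      ultimately show ?thesis
        by simp
    qed simp
    then show "finite {sdepth_decomposition D |D. stanley_decomposition n M (quot_component n J) D}"
      by (intro finite_subset[OF _ finite_insert[THEN iffD2, OF finite_atMost]]) blast
  qed (use D in blast)
  finally show ?thesis .
qed

section \<open>Independent sets of paths and cycles\<close>

lemma interval_partition_append:
  assumes "interval_partition \<Delta> L" "interval_partition \<Delta>' L'" "\<Delta> \<inter> \<Delta>' = {}"
  shows "interval_partition (\<Delta> \<union> \<Delta>') (L @ L')"
  using assms unfolding interval_partition_def by auto

text \<open>The new complex is the cone over \<Delta> with apex v. Enlarging only the upper ends
  puts G and G with v added into the same interval.\<close>

lemma interval_partition_insert_upper:
  assumes L: "interval_partition \<Delta> L" and v: "\<And>G. G \<in> \<Delta> \<Longrightarrow> v \<notin> G"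
  shows "interval_partition {G. G - {v} \<in> \<Delta>} (map (\<lambda>(E, F). (E, insert v F)) L)"
  unfolding interval_partition_def
proof (intro conjI allI)
  show "\<forall>(E, F)\<in>set (map (\<lambda>(E, F). (E, insert v F)) L). E \<subseteq> F"
    using interval_partitionD(1)[OF L] by fastforce
  fix G
  have "filter ((\<lambda>(E, F). E \<subseteq> G \<and> G \<subseteq> F) \<circ> (\<lambda>(E, F). (E, insert v F))) L
    = filter (\<lambda>(E, F). E \<subseteq> G - {v} \<and> G - {v} \<subseteq> F) L"
  proof (rule filter_cong[OF refl])
    fix x assume "x \<in> set L"
    moreover obtain E F where x: "x = (E, F)"
      by force
    ultimately have "v \<notin> E"
      using v interval_partition_bounds(1)[OF L, of E F] by auto
    then show "((\<lambda>(E, F). E \<subseteq> G \<and> G \<subseteq> F) \<circ> (\<lambda>(E, F). (E, insert v F))) x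
        = (case x of (E, F) \<Rightarrow> E \<subseteq> G - {v} \<and> G - {v} \<subseteq> F)"
      unfolding x by auto
  qed
  then show "length (filter (\<lambda>(E, F). E \<subseteq> G \<and> G \<subseteq> F) (map (\<lambda>(E, F). (E, insert v F)) L))
      = (if G \<in> {G. G - {v} \<in> \<Delta>} then 1 else 0)"
    using L unfolding interval_partition_def filter_map length_map by simp
qed

lemma interval_partition_insert_both:
  assumes L: "interval_partition \<Delta> L" and v: "\<And>G. G \<in> \<Delta> \<Longrightarrow> v \<notin> G"
  shows "interval_partition {G. v \<in> G \<and> G - {v} \<in> \<Delta>} (map (\<lambda>(E, F). (insert v E, insert v F)) L)"
  unfolding interval_partition_def
proof (intro conjI allI)
  show "\<forall>(E, F)\<in>set (map (\<lambda>(E, F). (insert v E, insert v F)) L). E \<subseteq> F"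
    using interval_partitionD(1)[OF L] by fastforce
  fix G
  have "filter ((\<lambda>(E, F). E \<subseteq> G \<and> G \<subseteq> F) \<circ> (\<lambda>(E, F). (insert v E, insert v F))) L
    = (if v \<in> G then filter (\<lambda>(E, F). E \<subseteq> G - {v} \<and> G - {v} \<subseteq> F) L else [])"
  proof (cases "v \<in> G")
    case True
    have "filter ((\<lambda>(E, F). E \<subseteq> G \<and> G \<subseteq> F) \<circ> (\<lambda>(E, F). (insert v E, insert v F))) L
      = filter (\<lambda>(E, F). E \<subseteq> G - {v} \<and> G - {v} \<subseteq> F) L"
    proof (rule filter_cong[OF refl])
      fix x assume "x \<in> set L"
      moreover obtain E F where x: "x = (E, F)"
        by force
      ultimately have "v \<notin> E"
        using v interval_partition_bounds(1)[OF L, of E F] by auto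
      then show "((\<lambda>(E, F). E \<subseteq> G \<and> G \<subseteq> F) \<circ> (\<lambda>(E, F). (insert v E, insert v F))) x
          = (case x of (E, F) \<Rightarrow> E \<subseteq> G - {v} \<and> G - {v} \<subseteq> F)"
        unfolding x using True by auto
    qed
    then show ?thesis
      using True by simp
  qed (auto simp: filter_empty_conv)
  then show "length (filter (\<lambda>(E, F). E \<subseteq> G \<and> G \<subseteq> F) (map (\<lambda>(E, F). (insert v E, insert v F)) L))
      = (if G \<in> {G. v \<in> G \<and> G - {v} \<in> \<Delta>} then 1 else 0)"
    using L unfolding interval_partition_def filter_map length_map by (simp del: length_0_conv)
qed

lemma interval_partition_image_Suc:
  assumes L: "interval_partition \<Delta> L"
  shows "interval_partition ((`) Suc ` \<Delta>) (map (\<lambda>(E, F). (Suc ` E, Suc ` F)) L)"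
  unfolding interval_partition_def
proof (intro conjI allI)
  show "\<forall>(E, F)\<in>set (map (\<lambda>(E, F). (Suc ` E, Suc ` F)) L). E \<subseteq> F"
    using interval_partitionD(1)[OF L] by fastforce
  fix G
  show "length (filter (\<lambda>(E, F). E \<subseteq> G \<and> G \<subseteq> F) (map (\<lambda>(E, F). (Suc ` E, Suc ` F)) L))
      = (if G \<in> (`) Suc ` \<Delta> then 1 else 0)"
  proof (cases "0 \<in> G")
    case True
    then have "filter ((\<lambda>(E, F). E \<subseteq> G \<and> G \<subseteq> F) \<circ> (\<lambda>(E, F). (Suc ` E, Suc ` F))) L = []"
      by (auto simp: filter_empty_conv)
    moreover have "G \<notin> (`) Suc ` \<Delta>"
      using True by auto
    ultimately show ?thesis
      unfolding filter_map length_map by simp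
  next
    case False
    have "G \<subseteq> range Suc"
      using False by (auto simp: image_iff) (metis not0_implies_Suc)
    then obtain H where H: "G = Suc ` H"
      by (auto simp: subset_image_iff)
    have "(\<lambda>(E, F). E \<subseteq> G \<and> G \<subseteq> F) \<circ> (\<lambda>(E, F). (Suc ` E, Suc ` F))
      = (\<lambda>(E, F). E \<subseteq> H \<and> H \<subseteq> F)"
      unfolding H by (auto simp: fun_eq_iff inj_image_subset_iff)
    moreover have "G \<in> (`) Suc ` \<Delta> \<longleftrightarrow> H \<in> \<Delta>"
      unfolding H by (auto simp: inj_image_eq_iff)
    ultimately show ?thesis
      using L unfolding interval_partition_def filter_map length_map by simp
  qed
qed

definition path_indep :: "nat \<Rightarrow> nat set set" where
  "path_indep m = {G. G \<subseteq> {1..m} \<and> (\<forall>i\<in>G. Suc i \<notin> G)}"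

definition cycle_indep :: "nat \<Rightarrow> nat set set" where
  "cycle_indep n = {G. G \<subseteq> {1..n} \<and> (\<forall>i\<in>G. Suc i \<notin> G) \<and> \<not> (n \<in> G \<and> 1 \<in> G)}"

text \<open>For m = 0 the truncated \<open>m - 1\<close> gives the empty path, which is what remains
  of two vertices when the first one is chosen.\<close>

fun path_intervals :: "nat \<Rightarrow> (nat set \<times> nat set) list" where
  "path_intervals 0 = [({}, {})]"
| "path_intervals (Suc 0) = [({}, {1})]"
| "path_intervals (Suc (Suc m)) =
    map (\<lambda>(E, F). (E, insert (m + 2) F)) (path_intervals m) @
    map (\<lambda>(E, F). (insert (m + 1) E, insert (m + 1) F)) (path_intervals (m - 1))"

text \<open>Removing n and its neighbours 1 and n - 1 leaves the path 2, ..., n - 2, hence the shift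
  by \<open>Suc\<close>.\<close>

definition cycle_intervals :: "nat \<Rightarrow> (nat set \<times> nat set) list" where
  "cycle_intervals n = path_intervals (n - 1) @ map (\<lambda>(E, F). (insert n E, insert n F))
    (map (\<lambda>(E, F). (Suc ` E, Suc ` F)) (path_intervals (n - 3)))"

text \<open>In a path with \<open>m + 2\<close> vertices, an independent set avoiding the vertex \<open>m + 1\<close> may or may not
  contain \<open>m + 2\<close>, while one containing \<open>m + 1\<close> avoids \<open>m\<close> and \<open>m + 2\<close>.\<close>

lemma path_indep_Suc_Suc:
  "path_indep (Suc (Suc m)) = {G. G - {m + 2} \<in> path_indep m} \<union>
     {G. m + 1 \<in> G \<and> G - {m + 1} \<in> path_indep (m - 1)}" (is "?L = ?A \<union> ?B")
proof (intro equalityI subsetI)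
  fix G assume G: "G \<in> ?L"
  show "G \<in> ?A \<union> ?B"
  proof (cases "m + 1 \<in> G")
    case True
    have "Suc i \<notin> G" if "i \<in> G" for i
      using that G by (auto simp: path_indep_def)
    from this[of m] this[of "m + 1"] have "m + 2 \<notin> G" "m \<notin> G"
      using True by (auto simp: One_nat_def)
    have "i \<in> {1..m - 1}" if i: "i \<in> G - {m + 1}" for i
    proof -
      have "i \<noteq> m" "i \<noteq> m + 2" "i \<noteq> m + 1" "1 \<le> i" "i \<le> m + 2"
        using \<open>m + 2 \<notin> G\<close> \<open>m \<notin> G\<close> i G by (auto simp: path_indep_def)
      then show ?thesis
        by simp
    qed
    then have "G - {m + 1} \<subseteq> {1..m - 1}"
      by blast
    then have "G - {m + 1} \<in> path_indep (m - 1)"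
      using G unfolding path_indep_def by blast
    then show ?thesis
      using True by blast
  next
    case False
    have "i \<in> {1..m}" if i: "i \<in> G - {m + 2}" for i
    proof -
      have "i \<noteq> m + 2" "i \<noteq> m + 1" "1 \<le> i" "i \<le> m + 2"
        using False i G by (auto simp: path_indep_def)
      then show ?thesis
        by simp
    qed
    then have "G - {m + 2} \<subseteq> {1..m}"
      by blast
    then have "G - {m + 2} \<in> path_indep m"
      using G unfolding path_indep_def by blast
    then show ?thesis
      by blast
  qed
next
  fix G assume "G \<in> ?A \<union> ?B"
  then show "G \<in> ?L"
  proof
    assume "G \<in> ?A"
    then have G: "i \<in> {1..m}" "Suc i \<notin> G - {m + 2}" if "i \<in> G" "i \<noteq> m + 2" for i
      using that unfolding path_indep_def by blast+
    have "i \<in> {1..Suc (Suc m)} \<and> Suc i \<notin> G" if "i \<in> G" for i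
    proof -
      have "i = m + 2 \<or> i \<in> {1..m} \<and> Suc i \<notin> G - {m + 2}"
        using G[OF that] by blast
      moreover have "Suc i \<in> G \<Longrightarrow> Suc i = m + 2 \<or> Suc i \<in> {1..m}"
        using G(1) by blast
      ultimately show ?thesis
        by auto
    qed
    then show ?thesis
      unfolding path_indep_def by blast
  next
    assume "G \<in> ?B"
    then have G: "i \<in> {1..m - 1}" "Suc i \<notin> G - {m + 1}" if "i \<in> G" "i \<noteq> m + 1" for i
      using that unfolding path_indep_def by blast+
    have "i \<in> {1..Suc (Suc m)} \<and> Suc i \<notin> G" if "i \<in> G" for i
    proof -
      have "i = m + 1 \<or> i \<in> {1..m - 1} \<and> Suc i \<notin> G - {m + 1}"
        using G[OF that] by blast
      moreover have "Suc i \<in> G \<Longrightarrow> Suc i = m + 1 \<or> Suc i \<in> {1..m - 1}"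
        using G(1) by blast
      ultimately show ?thesis
        by auto
    qed
    then show ?thesis
      unfolding path_indep_def by blast
  qed
qed

lemma interval_partition_path: "interval_partition (path_indep m) (path_intervals m)"
proof (induction m rule: path_intervals.induct)
  case 1
  have "path_indep 0 = {{}}"
    by (auto simp: path_indep_def)
  then show ?case
    by (auto simp: interval_partition_def)
next
  case 2
  have "{1..Suc 0} = {1}"
    by auto
  have "path_indep (Suc 0) = {{}, {1}}"
    unfolding path_indep_def \<open>{1..Suc 0} = {1}\<close> by (auto simp: subset_singleton_iff)
  then show ?case
    by (auto simp: interval_partition_def)
next
  case (3 m)
  show ?case
    unfolding path_intervals.simps path_indep_Suc_Suc
  proof (intro interval_partition_append interval_partition_insert_upper interval_partition_insert_both 3)
    show "{G. G - {m + 2} \<in> path_indep m} \<inter> {G. m + 1 \<in> G \<and> G - {m + 1} \<in> path_indep (m - 1)} = {}"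
      by (auto simp: path_indep_def)
  qed (auto simp: path_indep_def)
qed

text \<open>Each recursion step adds one vertex to the upper end and uses up at most three vertices
  of the path; the bound is the ceiling of m/3.\<close>

lemma card_path_intervals: "(E, F) \<in> set (path_intervals m) \<Longrightarrow> (m + 2) div 3 \<le> card F"
proof (induction m arbitrary: E F rule: path_intervals.induct)
  case (3 m)
  have F: "finite F'" "F' \<subseteq> {1..k}" if "(E', F') \<in> set (path_intervals k)" for E' F' k
    using interval_partition_bounds(2)[OF interval_partition_path that] finite_subset[of F' "{1..k}"]
    by (auto simp: path_indep_def)
  from 3(3) consider E' F' where "(E', F') \<in> set (path_intervals m)" "F = insert (m + 2) F'"
    | E' F' where "(E', F') \<in> set (path_intervals (m - 1))" "F = insert (m + 1) F'"
    by auto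
  then show ?case
  proof cases
    case 1
    then have "card F = Suc (card F')"
      using F[OF 1(1)] by (auto intro!: card_insert_disjoint)
    then show ?thesis
      using 3(1)[OF 1(1)] by simp
  next
    case 2
    then have "card F = Suc (card F')"
      using F[OF 2(1)] by (auto intro!: card_insert_disjoint)
    then show ?thesis
      using 3(2)[OF 2(1)] by (cases m) auto
  qed
qed auto

lemma cycle_indep_eq:
  assumes "n \<ge> 3"
  shows "cycle_indep n = path_indep (n - 1) \<union> {G. n \<in> G \<and> G - {n} \<in> (`) Suc ` path_indep (n - 3)}"
    (is "?L = ?A \<union> ?B")
proof (intro equalityI subsetI)
  fix G assume G: "G \<in> ?L"
  show "G \<in> ?A \<union> ?B"
  proof (cases "n \<in> G")
    case False
    have "i \<in> {1..n - 1}" if "i \<in> G" for i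
    proof -
      have "i \<in> {1..n}" "i \<noteq> n"
        using G that False by (auto simp: cycle_indep_def)
      then show ?thesis
        unfolding atLeastAtMost_iff by linarith
    qed
    then show ?thesis
      using G by (auto simp: cycle_indep_def path_indep_def)
  next
    case True
    \<comment> \<open>\<open>H\<close> is G without n, shifted down. As n belongs to G, neither 1
      nor n - 1 does, which excludes 0 and n - 2 from \<open>H\<close>.\<close>
    define H where "H = {i. Suc i \<in> G \<and> Suc i \<noteq> n}"
    have H: "Suc i \<in> {1..n} \<and> Suc i \<noteq> n \<and> Suc i \<noteq> 1 \<and> Suc (Suc i) \<noteq> n" if "i \<in> H" for i
      using True that G by (cases i) (auto simp: H_def cycle_indep_def One_nat_def)
    have "i \<in> {1..n - 3}" if "i \<in> H" for i
    proof -
      have "Suc i \<le> n" "Suc i \<noteq> n" "Suc i \<noteq> 1" "Suc (Suc i) \<noteq> n"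
        using H[OF that] by auto
      then show ?thesis
        unfolding atLeastAtMost_iff by linarith
    qed
    moreover have "Suc i \<notin> H" if "i \<in> H" for i
      using G that by (auto simp: H_def cycle_indep_def)
    ultimately have "H \<in> path_indep (n - 3)"
      unfolding path_indep_def by blast
    moreover have "G - {n} = Suc ` H"
    proof (intro equalityI subsetI)
      fix i assume "i \<in> G - {n}"
      moreover from this have "i \<noteq> 0"
        using G by (auto simp: cycle_indep_def)
      ultimately show "i \<in> Suc ` H"
        by (cases i) (auto simp: H_def)
    qed (auto simp: H_def)
    ultimately show ?thesis
      using True by auto
  qed
next
  fix G assume "G \<in> ?A \<union> ?B"
  then show "G \<in> ?L"
  proof
    assume "G \<in> ?A"
    then have G: "G \<subseteq> {1..n - 1}" "\<forall>i\<in>G. Suc i \<notin> G"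
      unfolding path_indep_def by blast+
    have "n \<notin> {1..n - 1}" "{1..n - 1} \<subseteq> {1..n}"
      using assms by auto
    then show ?thesis
      using G unfolding cycle_indep_def by blast
  next
    assume "G \<in> ?B"
    then have "n \<in> G" and "G - {n} \<in> (`) Suc ` path_indep (n - 3)"
      by simp_all
    from this(2) obtain H where "G - {n} = Suc ` H" "H \<in> path_indep (n - 3)"
      by (rule imageE)
    note H = \<open>n \<in> G\<close> this
    have G: "i \<in> {2..n - 2}" "Suc i \<notin> G - {n}" if "i \<in> G" "i \<noteq> n" for i
    proof -
      have "i \<in> Suc ` H"
        using that unfolding H(2)[symmetric] by simp
      then obtain j where "i = Suc j" "j \<in> H"
        by (rule imageE)
      moreover from this have "j \<in> {1..n - 3}" "Suc j \<notin> H"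
        using H(3) unfolding path_indep_def by blast+
      ultimately show "i \<in> {2..n - 2}" "Suc i \<notin> G - {n}"
        using assms unfolding H(2) by auto
    qed
    have "i \<in> {1..n} \<and> Suc i \<notin> G" if "i \<in> G" for i
    proof -
      have "i = n \<or> i \<in> {2..n - 2} \<and> Suc i \<notin> G - {n}"
        using G[OF that] by blast
      moreover have "Suc i \<in> G \<Longrightarrow> Suc i = n \<or> Suc i \<in> {2..n - 2}"
        using G(1) by blast
      ultimately show ?thesis
        using assms by auto
    qed
    moreover have "1 \<notin> G"
      using G(1)[of 1] assms by auto
    ultimately show ?thesis
      unfolding cycle_indep_def by blast
  qed
qed

lemma interval_partition_cycle:
  assumes "n \<ge> 3"
  shows "interval_partition (cycle_indep n) (cycle_intervals n)"
  unfolding cycle_indep_eq[OF assms] cycle_intervals_def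
proof (intro interval_partition_append interval_partition_insert_both interval_partition_image_Suc
    interval_partition_path)
  show "path_indep (n - 1) \<inter> {G. n \<in> G \<and> G - {n} \<in> (`) Suc ` path_indep (n - 3)} = {}"
    using assms by (auto simp: path_indep_def)
  show "n \<notin> G" if "G \<in> (`) Suc ` path_indep (n - 3)" for G
    using that assms by (auto simp: path_indep_def)
qed

text \<open>The path with n - 1 vertices gives exactly this bound, (n + 1) div 3; the intervals
  through n give (n - 1) div 3 + 1, which is at least as large.\<close>

lemma card_cycle_intervals:
  assumes "n \<ge> 3" "(E, F) \<in> set (cycle_intervals n)"
  shows "(n + 1) div 3 \<le> card F"
proof -
  from assms(2) consider "(E, F) \<in> set (path_intervals (n - 1))"
    | E' F' where "(E', F') \<in> set (path_intervals (n - 3))" "F = insert n (Suc ` F')"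
    by (auto simp: cycle_intervals_def)
  then show ?thesis
  proof cases
    case 1
    then show ?thesis
      using card_path_intervals[OF 1] assms(1) by simp
  next
    case 2
    have "F' \<subseteq> {1..n - 3}"
      using interval_partition_bounds(2)[OF interval_partition_path 2(1)] by (auto simp: path_indep_def)
    then have "finite F'" "n \<notin> Suc ` F'"
      using finite_subset[of F' "{1..n - 3}"] assms(1) by auto
    then have "card F = Suc (card F')"
      using 2(2) by (simp add: card_image)
    then show ?thesis
      using card_path_intervals[OF 2(1)] assms(1) by simp
  qed
qed

section \<open>Depth of quotients of the polynomial ring\<close>

text \<open>In the binomial expansion of (x + y) ^ (a + b) every term contains x ^ a or y ^
  b.\<close>

lemma (in subring_set) ideal_set_radical:
  assumes "ideal_set I"
  shows "ideal_set {f \<in> A. \<exists>e. f ^ e \<in> I}"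
  unfolding ideal_set_def
proof (intro conjI ballI)
  note I = ideal_setD[OF assms]
  have "0 ^ 1 \<in> I"
    using I(2) by simp
  then show "0 \<in> {f \<in> A. \<exists>e. f ^ e \<in> I}"
    using zero_mem by blast
  fix x assume x: "x \<in> {f \<in> A. \<exists>e. f ^ e \<in> I}"
  then obtain a where a: "x \<in> A" "x ^ a \<in> I"
    by blast
  show "c * x \<in> {f \<in> A. \<exists>e. f ^ e \<in> I}" if "c \<in> A" for c
  proof -
    have "(c * x) ^ a \<in> I"
      unfolding power_mult_distrib using a I(4) power_mem[OF that] by blast
    then show ?thesis
      using that a mult_mem by blast
  qed
  fix y assume y: "y \<in> {f \<in> A. \<exists>e. f ^ e \<in> I}"
  then obtain b where b: "y \<in> A" "y ^ b \<in> I"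
    by blast
  have of_nat_mem: "of_nat m \<in> A" for m
    by (induction m) (auto intro: zero_mem one_mem add_mem)
  have "(x + y) ^ (a + b) \<in> I"
    unfolding binomial_ring
  proof (rule ideal_set_sum[OF assms])
    fix i assume "i \<in> {..a + b}"
    show "of_nat (a + b choose i) * x ^ i * y ^ (a + b - i) \<in> I"
    proof (cases "a \<le> i")
      case True
      have "of_nat (a + b choose i) * x ^ i * y ^ (a + b - i)
        = (of_nat (a + b choose i) * x ^ (i - a) * y ^ (a + b - i)) * x ^ a"
        using True power_add[of x "i - a" a] by (simp add: mult_ac)
      then show ?thesis
        using a b by (simp only:) (intro I(4) mult_mem of_nat_mem power_mem)
    next
      case False
      then have "a + b - i = (a - i) + b"
        by simp
      then have "of_nat (a + b choose i) * x ^ i * y ^ (a + b - i)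
        = (of_nat (a + b choose i) * x ^ i * y ^ (a - i)) * y ^ b"
        by (simp add: mult_ac power_add)
      then show ?thesis
        using a b by (simp only:) (intro I(4) mult_mem of_nat_mem power_mem)
    qed
  qed
  then show "x + y \<in> {f \<in> A. \<exists>e. f ^ e \<in> I}"
    using a b add_mem by blast
qed blast

context poly_quotient
begin

section \<open>Regular sequences on the quotient module, expressed by ideals of the ring\<close>

lemma coset_mem_seq_mult_iff:
  assumes "set fs \<subseteq> polys_in {1..n}" "p \<in> polys_in {1..n}"
  shows "coset p \<in> seq_mult M fs \<longleftrightarrow> p \<in> foldl adjoin J fs"
proof -
  have fs: "fs ! i \<in> polys_in {1..n}" if "i < length fs" for i
    using assms(1) that by auto
  have finsum: "finsum M (\<lambda>i. fs ! i \<odot>\<^bsub>M\<^esub> g i) {..<length fs} = coset (\<Sum>i<length fs. fs ! i * a i)"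
    if "\<And>i. i < length fs \<Longrightarrow> a i \<in> polys_in {1..n}" "\<And>i. i < length fs \<Longrightarrow> g i = coset (a i)" for g a
  proof -
    have "finsum M (\<lambda>i. fs ! i \<odot>\<^bsub>M\<^esub> g i) {..<length fs} = finsum M (\<lambda>i. coset (fs ! i * a i)) {..<length fs}"
      using that fs mult_mem by (intro M.finsum_cong') auto
    also have "\<dots> = coset (\<Sum>i<length fs. fs ! i * a i)"
      using that fs mult_mem by (intro finsum_coset) auto
    finally show ?thesis .
  qed
  show ?thesis
  proof
    assume "coset p \<in> seq_mult M fs"
    then obtain g where g: "coset p = finsum M (\<lambda>i. fs ! i \<odot>\<^bsub>M\<^esub> g i) {..<length fs}"
        "g \<in> {..<length fs} \<rightarrow> carrier M"
      unfolding seq_mult_def by blast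
    have "\<exists>a. a \<in> polys_in {1..n} \<and> g i = coset a" if "i \<in> {..<length fs}" for i
      using funcset_mem[OF g(2) that] by auto
    then have "\<exists>a. \<forall>i\<in>{..<length fs}. a i \<in> polys_in {1..n} \<and> g i = coset (a i)"
      by (intro bchoice) blast
    then obtain a where a: "\<And>i. i < length fs \<Longrightarrow> a i \<in> polys_in {1..n}"
        "\<And>i. i < length fs \<Longrightarrow> g i = coset (a i)"
      by (meson lessThan_iff)
    have "p - (\<Sum>i<length fs. fs ! i * a i) \<in> J"
      using g(1) finsum[of a g] a coset_eq_iff by simp
    moreover have "p = (p - (\<Sum>i<length fs. fs ! i * a i)) + (\<Sum>i<length fs. fs ! i * a i)"
      by simp
    ultimately show "p \<in> foldl adjoin J fs"
      unfolding foldl_adjoin[OF ideal assms(1)] using a(1) by blast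
  next
    assume "p \<in> foldl adjoin J fs"
    then obtain q a where a: "p = q + (\<Sum>i<length fs. fs ! i * a i)" "q \<in> J"
        "\<forall>i<length fs. a i \<in> polys_in {1..n}"
      unfolding foldl_adjoin[OF ideal assms(1)] by blast
    have "coset p = coset (\<Sum>i<length fs. fs ! i * a i)"
      using a by (simp add: coset_eq_iff)
    also have "\<dots> = finsum M (\<lambda>i. fs ! i \<odot>\<^bsub>M\<^esub> coset (a i)) {..<length fs}"
      using finsum[of a "\<lambda>i. coset (a i)"] a(3) by simp
    finally show "coset p \<in> seq_mult M fs"
      unfolding seq_mult_def using a(3) by (intro CollectI exI[of _ "\<lambda>i. coset (a i)"]) auto
  qed
qed

lemma regular_sequence_imp_regular_on:
  assumes "set fs \<subseteq> polys_in {1..n}" "regular_sequence M fs"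
  shows "regular_on J fs"
  unfolding regular_on_def
proof (intro allI impI ballI)
  fix i v assume i: "i < length fs" and v: "v \<in> polys_in {1..n}"
    and mem: "fs ! i * v \<in> foldl adjoin J (take i fs)"
  have fs: "fs ! i \<in> polys_in {1..n}" "set (take i fs) \<subseteq> polys_in {1..n}"
    using i assms(1) set_take_subset by (fastforce, fast)
  have "fs ! i \<odot>\<^bsub>M\<^esub> coset v \<in> seq_mult M (take i fs)"
    using coset_mem_seq_mult_iff[OF fs(2), of "fs ! i * v"] mem fs v mult_mem by simp
  moreover have "coset v \<in> carrier M"
    using v by simp
  ultimately have "coset v \<in> seq_mult M (take i fs)"
    using assms(2) i unfolding regular_sequence_def by blast
  then show "v \<in> foldl adjoin J (take i fs)"
    using coset_mem_seq_mult_iff[OF fs(2) v] by blast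
qed

text \<open>Depth is a \<open>Max\<close>, so the set of lengths has to be finite and nonempty; the
  empty sequence is regular because 1 is not in \<open>J\<close>.\<close>

lemma depth_le:
  assumes I: "I \<subseteq> polys_in {1..n}" and "1 \<notin> J"
    and bound: "\<And>fs. set fs \<subseteq> I \<Longrightarrow> regular_on J fs \<Longrightarrow> length fs \<le> d"
  shows "depth I M \<le> d"
proof -
  let ?L = "{length fs | fs. set fs \<subseteq> I \<and> regular_sequence M fs}"
  have "?L \<subseteq> {..d}"
    using bound I regular_sequence_imp_regular_on by blast
  moreover have "regular_sequence M []"
  proof -
    have "coset 1 \<notin> seq_mult M []"
      using coset_mem_seq_mult_iff[of "[]" 1] one_mem assms(2) by simp
    moreover have "coset 1 \<in> carrier M"
      using one_mem by simp
    ultimately show ?thesis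
      unfolding regular_sequence_def by auto
  qed
  then have "?L \<noteq> {}"
    by (auto intro: exI[of _ "[]"])
  ultimately show ?thesis
    unfolding depth_def using finite_subset[of ?L "{..d}"] by (subst Max_le_iff) auto
qed

lemma graded_maximal_ideal_subset: "graded_maximal_ideal n \<subseteq> (polys_in {1..n} :: 'k mpoly set)"
proof -
  have "var ` {1..n} \<subseteq> carrier (poly_ring n :: 'k mpoly ring)"
    using var_mem by auto
  from J.genideal_ideal[OF this] show ?thesis
    unfolding graded_maximal_ideal_def using ideal_poly_ring_iff ideal_setD(1) by blast
qed

text \<open>The radical of \<open>I\<close> is an ideal, so it contains the maximal ideal as soon as
  it contains the variables; inhomogeneous f are thereby included.\<close>

lemma graded_maximal_ideal_nilpotent:
  assumes I: "ideal_set I" and vars: "\<And>i. i \<in> {1..n} \<Longrightarrow> \<exists>e. var i ^ e \<in> I"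
    and f: "f \<in> graded_maximal_ideal n"
  shows "\<exists>e. f ^ e \<in> I"
proof -
  have "graded_maximal_ideal n \<subseteq> {f \<in> polys_in {1..n}. \<exists>e. f ^ e \<in> I}"
    unfolding graded_maximal_ideal_def
    using ideal_set_radical[OF I] vars var_mem
    by (intro J.genideal_minimal) (auto simp: ideal_poly_ring_iff)
  then show ?thesis
    using f by blast
qed

end

section \<open>The edge ideal of the cycle\<close>

lemma ideal_set_nonface_polys:
  assumes down: "\<And>F G. G \<in> \<Delta> \<Longrightarrow> F \<subseteq> G \<Longrightarrow> F \<in> \<Delta>"
  shows "subring_set.ideal_set (polys_in {1..n}) (nonface_polys n \<Delta> :: 'k::field mpoly set)"
proof -
  interpret subring_set "polys_in {1..n} :: 'k mpoly set"
    by (rule subring_set_polys_in)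
  show ?thesis
    unfolding ideal_set_def
  proof (intro conjI ballI)
    fix x a :: "'k mpoly" assume x: "x \<in> nonface_polys n \<Delta>" and a: "a \<in> polys_in {1..n}"
    have "lookup (a * x) m = 0" if "keys m \<in> \<Delta>" for m
    proof (rule ccontr)
      assume "lookup (a * x) m \<noteq> 0"
      then have "m \<in> keys (a * x)"
        by (simp add: in_keys_iff)
      then obtain b c where "m = b + c" "c \<in> keys x"
        using keys_mult by blast
      then show False
        using x down[OF that, of "keys c"] by (auto simp: keys_add_nat nonface_polys_def in_keys_iff)
    qed
    then show "a * x \<in> nonface_polys n \<Delta>"
      using a x mult_mem unfolding nonface_polys_def by blast
  qed (auto simp: nonface_polys_def lookup_add intro: zero_mem add_mem)
qed

lemma cycle_indep_mono: "G \<in> cycle_indep n \<Longrightarrow> F \<subseteq> G \<Longrightarrow> F \<in> cycle_indep n"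
  unfolding cycle_indep_def by blast

lemma sqfree_mon_pair: "i \<noteq> j \<Longrightarrow> sqfree_mon {i, j} = var i * var j"
  by (simp add: sqfree_mon_insert) (simp add: sqfree_mon_def indicator_exp_def var_def)

lemma var_mult_var_nonface:
  assumes "i \<noteq> j" "i \<in> {1..n}" "j \<in> {1..n}" "{i, j} \<notin> \<Delta>"
  shows "(var i * var j :: 'k::field mpoly) \<in> nonface_polys n \<Delta>"
proof -
  have "(sqfree_mon {i, j} :: 'k mpoly) \<in> polys_in {1..n}"
    using assms by (intro sqfree_mon_mem) auto
  moreover have "lookup (sqfree_mon {i, j} :: 'k mpoly) m = 0" if "keys m \<in> \<Delta>" for m
    using that assms by (auto simp: sqfree_mon_def lookup_single when_def keys_indicator_exp)
  ultimately show ?thesis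
    using assms(1) by (simp add: nonface_polys_def flip: sqfree_mon_pair)
qed

text \<open>A monomial whose support is not independent contains both ends of an edge, so it is
  divisible by a generator.\<close>

lemma cycle_ideal_eq:
  assumes n: "n \<ge> 3"
  shows "cycle_ideal n = (nonface_polys n (cycle_indep n) :: 'k::field mpoly set)"
proof
  interpret subring_set "polys_in {1..n} :: 'k mpoly set"
    by (rule subring_set_polys_in)
  interpret R: cring "poly_ring n :: 'k mpoly ring"
    by (rule cring_poly_ring)
  let ?E = "{var i * var (i + 1) | i. 1 \<le> i \<and> i < n} \<union> {var n * var 1} :: 'k mpoly set"
  have E: "?E \<subseteq> carrier (poly_ring n)"
    using n by (auto intro!: mult_mem var_mem)
  show "cycle_ideal n \<subseteq> (nonface_polys n (cycle_indep n) :: 'k mpoly set)"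
    unfolding cycle_ideal_def
  proof (rule R.genideal_minimal)
    show "ideal (nonface_polys n (cycle_indep n)) (poly_ring n :: 'k mpoly ring)"
      using ideal_set_nonface_polys[OF cycle_indep_mono] by (simp add: ideal_poly_ring_iff)
    show "?E \<subseteq> nonface_polys n (cycle_indep n)"
    proof (intro Un_least subsetI)
      fix x assume "x \<in> {var i * var (i + 1) | i. 1 \<le> i \<and> i < n}"
      then obtain i where "x = var i * var (i + 1)" "1 \<le> i" "i < n"
        by blast
      then show "x \<in> nonface_polys n (cycle_indep n)"
        by (auto intro!: var_mult_var_nonface simp: cycle_indep_def)
    next
      fix x :: "'k mpoly" assume "x \<in> {var n * var 1}"
      then show "x \<in> nonface_polys n (cycle_indep n)"
        using n by (auto intro!: var_mult_var_nonface simp: cycle_indep_def)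
    qed
  qed
  have "ideal (cycle_ideal n) (poly_ring n :: 'k mpoly ring)"
    unfolding cycle_ideal_def using E by (rule R.genideal_ideal)
  then have ideal: "ideal_set (cycle_ideal n :: 'k mpoly set)"
    by (simp add: ideal_poly_ring_iff)
  have mem: "(var i * var j :: 'k mpoly) \<in> cycle_ideal n"
    if "var i * var j \<in> ?E" for i j
    using that R.genideal_self[OF E] unfolding cycle_ideal_def by blast
  show "(nonface_polys n (cycle_indep n) :: 'k mpoly set) \<subseteq> cycle_ideal n"
  proof
    fix p :: "'k mpoly" assume p: "p \<in> nonface_polys n (cycle_indep n)"
    have "single m (lookup p m) \<in> cycle_ideal n" if m: "m \<in> keys p" for m
    proof -
      have sub: "keys m \<subseteq> {1..n}" and "keys m \<notin> cycle_indep n"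
        using p m by (auto simp: nonface_polys_def polys_in_def in_keys_iff)
      then consider i where "i \<in> keys m" "i + 1 \<in> keys m" | "n \<in> keys m" "1 \<in> keys m"
        unfolding cycle_indep_def Suc_eq_plus1 by blast
      then obtain i j where ij: "i \<noteq> j" "i \<in> keys m" "j \<in> keys m" "(var i * var j :: 'k mpoly) \<in> ?E"
      proof cases
        case 1
        then have "1 \<le> i" "i < n"
          using sub by auto
        with 1 show ?thesis
          by (intro that[of i "i + 1"]) auto
      next
        case 2
        with n show ?thesis
          by (intro that[of n 1]) auto
      qed
      let ?m = "m - indicator_exp {i, j}"
      have "single m (lookup p m) = single ?m (lookup p m) * (var i * var j)"
        using ij minus_indicator_exp[of "{i, j}" m] by (simp add: sqfree_mon_def mult_single flip: sqfree_mon_pair)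
      moreover have "keys ?m \<subseteq> keys m"
        by (auto simp: in_keys_iff lookup_minus)
      then have "single ?m (lookup p m) \<in> polys_in {1..n}"
        using sub by (auto simp: polys_in_def)
      ultimately show ?thesis
        using ideal_setD(4)[OF ideal mem[OF ij(4)]] by simp
    qed
    then have "(\<Sum>m\<in>keys p. single m (lookup p m)) \<in> cycle_ideal n"
      by (intro ideal_set_sum[OF ideal])
    then show "p \<in> cycle_ideal n"
      by (simp only: poly_mapping_sum_single)
  qed
qed

section \<open>Stanley depth bound and facet bound for the cycle\<close>

locale cycle_quotient =
  fixes n :: nat and J :: "'k::field mpoly set"
  assumes n: "n \<ge> 3" and J: "J = nonface_polys n (cycle_indep n)"

sublocale cycle_quotient \<subseteq> poly_quotient n J
  using ideal_set_nonface_polys[OF cycle_indep_mono] by unfold_locales (simp add: J)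

context cycle_quotient
begin

lemma one_notin_J: "1 \<notin> J"
proof
  assume "1 \<in> J"
  moreover have "{} \<in> cycle_indep n"
    by (simp add: cycle_indep_def)
  ultimately have "lookup (1 :: 'k mpoly) 0 = 0"
    unfolding J nonface_polys_def by force
  then show False
    by simp
qed

lemma sdepth_cycle_ge: "(n + 1) div 3 \<le> sdepth n M (quot_component n J)"
  by (rule sdepth_ge[OF J interval_partition_cycle[OF n]])
    (use card_cycle_intervals[OF n] in \<open>auto simp: cycle_indep_def\<close>)

lemma edge_mem:
  assumes "i \<in> {1..n}" "j \<in> {1..n}" "j = i + 1 \<or> i = j + 1 \<or> {i, j} = {1, n}"
  shows "var i * var j \<in> J"
proof -
  have "i \<noteq> j" "{i, j} \<notin> cycle_indep n"
    using assms n unfolding cycle_indep_def Suc_eq_plus1 doubleton_eq_iff by auto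
  then show ?thesis
    unfolding J using assms by (intro var_mult_var_nonface)
qed

lemma var_times_sqfree_mon_mem:
  assumes "finite F" "F \<subseteq> {1..n}" "i \<in> {1..n}" "j \<in> F" "j = i + 1 \<or> i = j + 1 \<or> {i, j} = {1, n}"
  shows "var i * sqfree_mon F \<in> J"
proof -
  have "sqfree_mon F = var j * (sqfree_mon (F - {j}) :: 'k mpoly)"
    using assms by (subst sqfree_mon_insert[symmetric]) (auto simp: insert_absorb)
  moreover have "var i * var j \<in> J" "(sqfree_mon (F - {j}) :: 'k mpoly) \<in> polys_in {1..n}"
    using assms by (auto intro!: edge_mem sqfree_mon_mem)
  ultimately show ?thesis
    using ideal_setD(4)[OF ideal, of "var i * var j" "sqfree_mon (F - {j})"] by (simp add: mult_ac)
qed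

lemma lookup_indicator_exp_J:
  assumes "p \<in> J" "finite F" "F \<in> cycle_indep n"
  shows "lookup p (indicator_exp F) = 0"
  using assms keys_indicator_exp unfolding J nonface_polys_def by auto

text \<open>If \<open>n\<close> is not congruent to 1 modulo 3, the vertices \<open>1, 4, 7, \<dots>\<close> form a facet, and the
  corresponding monomial yields a prime \<open>J : x\<^sub>F\<close> of dimension \<open>(n + 1) div 3\<close>.\<close>

lemma regular_length_le_facet:
  assumes n3: "n mod 3 \<noteq> 1" and fs: "set fs \<subseteq> graded_maximal_ideal n" "regular_on J fs"
  shows "length fs \<le> (n + 1) div 3"
proof -
  define t where "t = (n + 1) div 3"
  define F where "F = (\<lambda>i. 3 * i + 1) ` {..<t}"
  \<comment> \<open>Squares are taken because x_F lies in the ideal of the variables of F, whereas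
    the squarefree monomial x_F avoids the ideal of their squares modulo \<open>J\<close>.\<close>
  define ys where "ys = map (\<lambda>i. var (3 * i + 1) ^ 2 :: 'k mpoly) [0..<t]"
  define zs where "zs = (map var (sorted_list_of_set ({1..n} - F)) :: 'k mpoly list)"
  define g where "g i = (if i = t then sqfree_mon F else (0 :: 'k mpoly))" for i
  have n_cases: "n = 3 * t \<or> n = 3 * t - 1" and t: "t > 0"
    using n3 n unfolding t_def by presburger+
  have "finite F"
    by (simp add: F_def)
  have F: "F \<subseteq> {1..n}" "F \<in> cycle_indep n"
  proof -
    have bound: "1 \<le> i" "i + 1 \<le> n" if "i \<in> F" for i
    proof -
      from that obtain j where "j < t" "i = 3 * j + 1"
        unfolding F_def by blast
      then show "1 \<le> i" "i + 1 \<le> n"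
        using n_cases by linarith+
    qed
    have "Suc i \<notin> F" if "i \<in> F" for i
    proof
      have mod: "j mod 3 = 1" if "j \<in> F" for j
        using that unfolding F_def by auto
      assume "Suc i \<in> F"
      with mod[OF this] mod[OF that] show False
        by presburger
    qed
    moreover show "F \<subseteq> {1..n}"
      using bound by fastforce
    moreover have "n \<notin> F"
      using bound(2)[of n] by auto
    ultimately show "F \<in> cycle_indep n"
      unfolding cycle_indep_def by blast
  qed
  have ys: "set ys \<subseteq> polys_in {1..n}"
    using F(1) unfolding ys_def F_def by (auto intro!: power_mem var_mem)
  have zs: "set zs \<subseteq> polys_in {1..n}"
    unfolding zs_def by (auto intro!: var_mem)
  have len: "length ys = t"
    by (simp add: ys_def)
  show ?thesis
    unfolding t_def[symmetric] len[symmetric]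
  \<comment> \<open>With w = 0 and x_F as the only nonzero value, placed on the face
    \<open>ys\<close>, the syzygy is 0.\<close>
  proof (rule regular_on_length_le[OF ideal _ fs(2) ys zero_mem zs])
    show "set fs \<subseteq> polys_in {1..n}"
      using fs(1) graded_maximal_ideal_subset by blast
    let ?ys = "ys @ 0 # zs"
    have ys': "set ?ys \<subseteq> polys_in {1..n}"
      using ys zs zero_mem by simp
    fix f assume f: "f \<in> set fs"
    show "\<exists>e. f ^ e \<in> foldl adjoin J ?ys"
    proof (rule graded_maximal_ideal_nilpotent)
      show "ideal_set (foldl adjoin J ?ys)"
        using ideal_set_foldl_adjoin[OF ideal ys'] .
      show "f \<in> graded_maximal_ideal n"
        using f fs(1) by blast
      fix i assume i: "i \<in> {1..n}"
      show "\<exists>e. var i ^ e \<in> foldl adjoin J ?ys"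
      proof (cases "i \<in> F")
        case True
        then have "var i ^ 2 \<in> set ?ys"
          by (auto simp: F_def ys_def)
        then show ?thesis
          using mem_foldl_adjoin[OF ideal ys'] by blast
      next
        case False
        then have "var i ^ 1 \<in> set ?ys"
          using i by (simp add: zs_def)
        then show ?thesis
          using mem_foldl_adjoin[OF ideal ys'] by blast
      qed
    qed
  next
    show "g i \<in> polys_in {1..n}" for i
      using F(1) \<open>finite F\<close> zero_mem by (auto simp: g_def intro: sqfree_mon_mem)
    fix z i assume "z \<in> set zs"
    then obtain j where j: "z = var j" "j \<in> {1..n}" "j \<notin> F"
      by (auto simp: zs_def)
    have "\<exists>k\<in>F. k = j + 1 \<or> j = k + 1 \<or> {j, k} = {1, n}"
    proof -
      define q where "q = j div 3"
      have notin: "j \<noteq> 3 * i + 1" if "i < t" for i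
        using that j(3) unfolding F_def by blast
      have mem: "3 * i + 1 \<in> F" if "i < t" for i
        using that unfolding F_def by blast
      have "j = 3 * q \<or> j = 3 * q + 1 \<or> j = 3 * q + 2"
        unfolding q_def by presburger
      then consider "j = 3 * q" | "j = 3 * q + 1" | "j = 3 * q + 2"
        by blast
      then show ?thesis
      proof cases
        case 1
        show ?thesis
        proof (cases "q < t")
          case True
          then show ?thesis
            using mem[of q] 1 by auto
        next
          case False
          \<comment> \<open>Here n = 3 t, and the last vertex meets F by wrapping around to vertex
            1.\<close>
          then have "j = n"
            using 1 n_cases j(2) by auto
          then show ?thesis
            using mem[of 0] t by auto
        qed
      next
        case 2
        then have "q < t"
          using n_cases j(2) by auto
        then show ?thesis
          using notin[of q] 2 by blast
      next
        case 3
        then have "q < t"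
          using n_cases j(2) by auto
        then show ?thesis
          using mem[of q] 3 by (intro bexI[of _ "3 * q + 1"]) auto
      qed
    qed
    then have "z * sqfree_mon F \<in> J"
      using var_times_sqfree_mon_mem[OF \<open>finite F\<close> F(1) j(2)] j(1) by blast
    then show "z * g i \<in> J"
      using ideal_setD(2)[OF ideal] by (simp add: g_def)
  next
    have "(\<Sum>i<length ys. (-1) ^ i * ys ! i * g i) = 0"
      by (intro sum.neutral) (auto simp: g_def len)
    then show "(\<Sum>i<length ys. (-1) ^ i * ys ! i * g i) + (-1) ^ length ys * 0 * g (length ys) \<in> J"
      using ideal_setD(2)[OF ideal] by simp
  next
    show "g (length ys) \<notin> foldl adjoin J ys"
    proof
      assume "g (length ys) \<in> foldl adjoin J ys"
      then obtain q a where a: "sqfree_mon F = q + (\<Sum>i<length ys. ys ! i * a i)" "q \<in> J"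
        unfolding foldl_adjoin[OF ideal ys] by (auto simp: g_def len)
      have "lookup (ys ! i * a i) (indicator_exp F) = 0" if "i < length ys" for i
      proof (rule ccontr)
        let ?j = "3 * i + 1"
        have ysi: "ys ! i = single (single ?j 2) 1"
          using that by (simp add: ys_def var_def power2_eq_square mult_single single_add[symmetric])
        assume "lookup (ys ! i * a i) (indicator_exp F) \<noteq> 0"
        then have "indicator_exp F \<in> keys (a i * single (single ?j 2) 1)"
          unfolding ysi by (simp add: in_keys_iff mult.commute)
        then obtain m where "indicator_exp F = m + single ?j 2"
          using keys_times_single by blast
        then have "lookup (indicator_exp F) ?j \<ge> 2"
          by (simp add: lookup_add)
        then show False
          using \<open>finite F\<close> by (simp add: lookup_indicator_exp split: if_splits)
      qed
      then have "lookup (sqfree_mon F :: 'k mpoly) (indicator_exp F) = 0"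
        unfolding a(1) using lookup_indicator_exp_J[OF a(2) \<open>finite F\<close> F(2)]
        by (simp add: lookup_add lookup_sum)
      then show False
        by (simp add: sqfree_mon_def)
    qed
  qed
qed

end

section \<open>The cross-polytope and its fundamental cycle\<close>

lemma lookup_var_times_indicator_exp:
  assumes "finite F"
  shows "lookup (var i * a :: 'k::field mpoly) (indicator_exp F)
    = (if i \<in> F then lookup a (indicator_exp (F - {i})) else 0)"
proof (cases "i \<in> F")
  case True
  then have "indicator_exp F = indicator_exp (F - {i}) + single i 1"
    using indicator_exp_insert[of "F - {i}" i] assms by (simp add: insert_absorb add.commute)
  then show ?thesis
    using True lookup_times_single[of a "single i 1" "indicator_exp (F - {i})"]
    by (simp add: var_def mult.commute)
next
  case False
  have "indicator_exp F \<notin> keys (a * single (single i 1) 1)"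
  proof
    assume "indicator_exp F \<in> keys (a * single (single i 1) 1)"
    then obtain m where "indicator_exp F = m + single i 1"
      using keys_times_single by blast
    then have "lookup (indicator_exp F) i \<noteq> 0"
      by (simp add: lookup_add)
    then show False
      using False assms by (simp add: lookup_indicator_exp)
  qed
  then show ?thesis
    using False by (simp add: var_def in_keys_iff mult.commute)
qed

text \<open>The functional below is evaluation of a cochain of the independence complex on the
  fundamental cycle of the boundary of the cross-polytope with the antipodal pairs
  \<open>{3 i + 1, 3 i + 2}\<close>, \<open>i < k\<close>.\<close>

definition cross_facet :: "nat \<Rightarrow> nat set \<Rightarrow> nat set" where
  "cross_facet k B = (\<lambda>i. 3 * i + 1) ` B \<union> (\<lambda>i. 3 * i + 2) ` ({..<k} - B)"

definition cross_functional :: "nat \<Rightarrow> 'k::field mpoly \<Rightarrow> 'k" where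
  "cross_functional k p = (\<Sum>B\<in>Pow {..<k}. (-1) ^ card B * lookup p (indicator_exp (cross_facet k B)))"

lemma finite_cross_facet: "B \<subseteq> {..<k} \<Longrightarrow> finite (cross_facet k B)"
  using finite_subset[of B "{..<k}"] by (simp add: cross_facet_def)

lemma mem_cross_facet:
  "3 * i + 1 \<in> cross_facet k B \<longleftrightarrow> i \<in> B" "3 * i + 2 \<in> cross_facet k B \<longleftrightarrow> i < k \<and> i \<notin> B"
proof -
  have "3 * i + 1 \<noteq> 3 * j + 2" for j
    by presburger
  then show "3 * i + 1 \<in> cross_facet k B \<longleftrightarrow> i \<in> B"
    by (auto simp: cross_facet_def image_iff)
  have "3 * i + 2 \<noteq> 3 * j + 1" for j
    by presburger
  then show "3 * i + 2 \<in> cross_facet k B \<longleftrightarrow> i < k \<and> i \<notin> B"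
    by (auto simp: cross_facet_def image_iff)
qed

lemma cross_facet_insert:
  assumes "i < k" "i \<notin> B"
  shows "cross_facet k (insert i B) - {3 * i + 1} = cross_facet k B - {3 * i + 2}"
proof -
  define D where "D = (\<lambda>i. 3 * i + 1) ` B \<union> (\<lambda>i. 3 * i + 2) ` ({..<k} - insert i B)"
  have ne: "3 * i + 1 \<noteq> 3 * j + 2" "3 * i + 2 \<noteq> 3 * j + 1" for j
    by presburger+
  have "3 * i + 1 \<notin> D"
    unfolding D_def using assms(2) ne(1) by auto
  moreover have "3 * i + 2 \<notin> D"
    unfolding D_def using ne(2) by auto
  moreover have "cross_facet k (insert i B) = insert (3 * i + 1) D"
    by (auto simp: cross_facet_def D_def)
  moreover have "{..<k} - B = insert i ({..<k} - insert i B)"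
    using assms by auto
  then have "cross_facet k B = insert (3 * i + 2) D"
    by (simp add: cross_facet_def D_def)
  ultimately show ?thesis
    by simp
qed

lemma cross_functional_add: "cross_functional k (p + q) = cross_functional k p + cross_functional k q"
  by (simp add: cross_functional_def lookup_add algebra_simps sum.distrib)

lemma cross_functional_sum: "cross_functional k (sum f I) = (\<Sum>i\<in>I. cross_functional k (f i))"
proof (induction I rule: infinite_finite_induct)
  case (insert i I)
  then show ?case
    by (simp add: cross_functional_add)
qed (simp_all add: cross_functional_def)

text \<open>The facets for B and \<open>insert i B\<close> share a ridge and have opposite signs.
  Both read the coefficient of \<open>a\<close> at this ridge, one through each variable of the
  pair. This is closedness of the fundamental cycle.\<close>

lemma cross_functional_pair:
  assumes "i < k"
  shows "cross_functional k ((var (3 * i + 1) + var (3 * i + 2)) * a) = 0"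
proof -
  let ?K = "{..<k} - {i}"
  define f where "f B = (-1) ^ card B *
    lookup ((var (3 * i + 1) + var (3 * i + 2)) * a) (indicator_exp (cross_facet k B))" for B
  have K: "{..<k} = insert i ?K"
    using assms by auto
  have cancel: "f (insert i B) = - f B" if B: "B \<in> Pow ?K" for B
  proof -
    have fin: "finite B" "finite (cross_facet k B)" "finite (cross_facet k (insert i B))"
      using B assms finite_subset[of B ?K] by (auto intro!: finite_cross_facet)
    have "i \<notin> B"
      using B by auto
    then have "f (insert i B) = - ((-1) ^ card B *
        lookup a (indicator_exp (cross_facet k (insert i B) - {3 * i + 1})))"
      unfolding f_def distrib_right lookup_add
      using fin mem_cross_facet[of i k "insert i B"] by (simp add: lookup_var_times_indicator_exp)
    also have "\<dots> = - ((-1) ^ card B * lookup a (indicator_exp (cross_facet k B - {3 * i + 2})))"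
      using cross_facet_insert[OF assms \<open>i \<notin> B\<close>] by simp
    also have "\<dots> = - f B"
      unfolding f_def distrib_right lookup_add
      using fin \<open>i \<notin> B\<close> mem_cross_facet[of i k B] assms by (simp add: lookup_var_times_indicator_exp)
    finally show ?thesis .
  qed
  have "cross_functional k ((var (3 * i + 1) + var (3 * i + 2)) * a) = sum f (Pow (insert i ?K))"
    unfolding cross_functional_def f_def K[symmetric] ..
  also have "\<dots> = sum f (Pow ?K) + sum f (insert i ` Pow ?K)"
    unfolding Pow_insert by (intro sum.union_disjoint) auto
  also have "sum f (insert i ` Pow ?K) = (\<Sum>B\<in>Pow ?K. f (insert i B))"
    by (subst sum.reindex) (auto simp: inj_on_def)
  also have "\<dots> = - sum f (Pow ?K)"
    using cancel by (simp add: sum_negf)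
  finally show ?thesis
    by simp
qed

context cycle_quotient
begin

text \<open>For \<open>n = 3 k + 1\<close> and \<open>F\<^sub>j = {2, 5, \<dots>, 3 j - 1, 3 j + 4, \<dots>, 3 k + 1}\<close>, \<open>j \<le> k\<close>, the sum of
  the duals of the faces \<open>F\<^sub>j\<close> is a cocycle of the independence complex. It is moved to the Koszul
  complex of the elements \<open>x\<^bsub>3j+1\<^esub> + x\<^bsub>3j+2\<^esub>\<close>, \<open>x\<^sub>n\<close> and \<open>x\<^bsub>3j+3\<^esub>\<close>, in which the cross-polytope
  becomes a single face.\<close>

lemma regular_length_le_cross_polytope:
  assumes k: "n = 3 * k + 1" and fs: "set fs \<subseteq> graded_maximal_ideal n" "regular_on J fs"
  shows "length fs \<le> k"
proof -
  define F where "F j = (\<lambda>i. 3 * i + 2) ` {..<j} \<union> (\<lambda>i. 3 * i + 4) ` {j..<k}" for j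
  define \<theta> where "\<theta> j = (var (3 * j + 1) + var (3 * j + 2) :: 'k mpoly)" for j
  define ys where "ys = map \<theta> [0..<k]"
  define zs where "zs = map (\<lambda>j. var (3 * j + 3) :: 'k mpoly) [0..<k]"
  \<comment> \<open>Beyond k the sets \<open>F j\<close> would leave {1..n}; the value 0 keeps
    \<open>g\<close> inside the ring.\<close>
  define g where "g j = (if j \<le> k then sqfree_mon (F j) else (0 :: 'k mpoly))" for j
  have kpos: "k > 0"
    using k n by simp
  have F_fin: "finite (F j)" for j
    by (simp add: F_def)
  have F_sub: "F j \<subseteq> {1..n}" if "j \<le> k" for j
    using that k unfolding F_def by auto
  have F_mem: "i < j \<Longrightarrow> 3 * i + 2 \<in> F j" "j \<le> i \<Longrightarrow> i < k \<Longrightarrow> 3 * i + 4 \<in> F j" for i j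
    unfolding F_def by auto
  have \<theta>: "\<theta> j \<in> polys_in {1..n}" if "j < k" for j
    using that k unfolding \<theta>_def by (intro add_mem var_mem) auto
  have ys: "set ys \<subseteq> polys_in {1..n}"
    using \<theta> by (auto simp: ys_def)
  have zs: "set zs \<subseteq> polys_in {1..n}"
    using k by (auto simp: zs_def intro!: var_mem)
  have xn: "var n \<in> (polys_in {1..n} :: 'k mpoly set)"
    using n by (intro var_mem) auto
  have len: "length ys = k"
    by (simp add: ys_def)
  have g_mem: "g i \<in> polys_in {1..n}" for i
    using F_sub F_fin zero_mem by (auto simp: g_def intro: sqfree_mon_mem)
  show ?thesis
    unfolding len[symmetric]
  proof (rule regular_on_length_le[OF ideal _ fs(2) ys xn zs])
    show "set fs \<subseteq> polys_in {1..n}"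
      using fs(1) graded_maximal_ideal_subset by blast
    let ?ys = "ys @ var n # zs"
    let ?I = "foldl adjoin J ?ys"
    have ys': "set ?ys \<subseteq> polys_in {1..n}"
      using ys zs xn by simp
    have I: "ideal_set ?I"
      using ideal_set_foldl_adjoin[OF ideal ys'] .
    fix f assume f: "f \<in> set fs"
    show "\<exists>e. f ^ e \<in> ?I"
    proof (rule graded_maximal_ideal_nilpotent[OF I])
      show "f \<in> graded_maximal_ideal n"
        using f fs(1) by blast
      fix v assume v: "v \<in> {1..n}"
      \<comment> \<open>The two variables of a pair form an edge, so modulo \<open>J\<close>
        multiplying their sum by either of them gives its square.\<close>
      have sq: "(var (3 * j + 1) :: 'k mpoly)\<^sup>2 \<in> ?I" "(var (3 * j + 2) :: 'k mpoly)\<^sup>2 \<in> ?I" if j: "j < k" for j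
      proof -
        let ?x = "var (3 * j + 1) :: 'k mpoly" and ?y = "var (3 * j + 2) :: 'k mpoly"
        have xy: "?x \<in> polys_in {1..n}" "?y \<in> polys_in {1..n}" "?x * ?y \<in> J"
          using j k by (auto intro!: var_mem edge_mem)
        have "\<theta> j \<in> set ?ys"
          using j by (simp add: ys_def)
        then have "\<theta> j \<in> ?I"
          by (rule mem_foldl_adjoin[OF ideal ys'])
        then have "?x * \<theta> j - ?x * ?y \<in> ?I" "?y * \<theta> j - ?x * ?y \<in> ?I"
          using xy subset_foldl_adjoin ideal_setD(4,6)[OF I] by blast+
        then show "?x\<^sup>2 \<in> ?I" "?y\<^sup>2 \<in> ?I"
          by (simp_all add: \<theta>_def power2_eq_square algebra_simps)
      qed
      define j where "j = (v - 1) div 3"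
      have "v = n \<or> j < k \<and> (v = 3 * j + 1 \<or> v = 3 * j + 2 \<or> v = 3 * j + 3)"
        using v k unfolding j_def atLeastAtMost_iff by presburger
      then consider "v = n" | "j < k" "v = 3 * j + 1" | "j < k" "v = 3 * j + 2" | "j < k" "v = 3 * j + 3"
        by blast
      then show "\<exists>e. var v ^ e \<in> ?I"
      proof cases
        case 1
        then have "var v ^ 1 \<in> set ?ys"
          by simp
        then show ?thesis
          using mem_foldl_adjoin[OF ideal ys'] by blast
      next
        case 2
        then show ?thesis
          using sq(1) by blast
      next
        case 3
        then show ?thesis
          using sq(2) by blast
      next
        case 4
        then have "var v ^ 1 \<in> set ?ys"
          by (auto simp: zs_def)
        then show ?thesis
          using mem_foldl_adjoin[OF ideal ys'] by blast
      qed
    qed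
  next
    show "g i \<in> polys_in {1..n}" for i
      by (rule g_mem)
    fix z i assume "z \<in> set zs"
    then obtain j where j: "z = var (3 * j + 3)" "j < k"
      by (auto simp: zs_def)
    show "z * g i \<in> J"
    proof (cases "i \<le> k")
      case True
      \<comment> \<open>Each F i contains a neighbour of every multiple of 3 up to 3k: the one below
        if j < i, the one above otherwise.\<close>
      have "\<exists>v\<in>F i. v = (3 * j + 3) + 1 \<or> 3 * j + 3 = v + 1 \<or> {3 * j + 3, v} = {1, n}"
      proof (cases "j < i")
        case True
        then show ?thesis
          using F_mem(1) by (intro bexI[of _ "3 * j + 2"]) auto
      next
        case False
        then show ?thesis
          using F_mem(2)[of i j] j(2) by (intro bexI[of _ "3 * j + 4"]) auto
      qed
      moreover have "3 * j + 3 \<in> {1..n}"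
        using j(2) k by simp
      ultimately show ?thesis
        unfolding g_def j(1) using var_times_sqfree_mon_mem[OF F_fin F_sub[OF True]] True by auto
    next
      case False
      then show ?thesis
        using ideal_setD(2)[OF ideal] by (simp add: g_def)
    qed
  next
    define h where "h j = var (3 * j + 1) * (sqfree_mon (F j) :: 'k mpoly)" for j
    \<comment> \<open>Passing from F j to F (j + 1) exchanges 3j + 4 for 3j + 2, and 3j + 4 = 3(j +
      1) + 1. Hence \<open>\<theta> j * g j\<close> splits into consecutive terms of
      \<open>h\<close>.\<close>
    have swap: "var (3 * j + 2) * (sqfree_mon (F j) :: 'k mpoly) = h (Suc j)" if j: "j < k" for j
    proof -
      define C where "C = (\<lambda>i. 3 * i + 2) ` {..<j} \<union> (\<lambda>i. 3 * i + 4) ` {Suc j..<k}"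
      have "3 * j + 4 \<notin> C" "3 * j + 2 \<notin> C"
        unfolding C_def by (auto simp: image_iff; presburger)+
      moreover have "F j = insert (3 * j + 4) C"
      proof -
        have "{j..<k} = insert j {Suc j..<k}"
          using j by auto
        then show ?thesis
          unfolding F_def C_def by simp
      qed
      moreover have "F (Suc j) = insert (3 * j + 2) C"
        unfolding F_def C_def by (auto simp: lessThan_Suc)
      moreover have "3 * Suc j + 1 = 3 * j + 4" "finite C"
        by (simp_all add: C_def)
      ultimately show ?thesis
        unfolding h_def by (simp only: sqfree_mon_insert not_False_eq_True mult.left_commute)
    qed
    have \<theta>h: "\<theta> j * g j = h j + h (Suc j)" if "j < k" for j
      using swap[OF that] that by (simp add: \<theta>_def g_def h_def distrib_right)
    \<comment> \<open>The alternating sum telescopes. The final term is supplied by w = x_n, as n =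
      3k + 1 makes it \<open>h k\<close>. What remains is x_1 times a monomial containing x_n, which
      is divisible by the closing edge.\<close>
    have "(\<Sum>j<m. (-1) ^ j * (h j + h (Suc j))) + (-1) ^ m * h m = h 0" for m
      by (induction m) (simp_all add: algebra_simps)
    from this[of k] have "(\<Sum>j<k. (-1) ^ j * (\<theta> j * g j)) + (-1) ^ k * (var n * g k) = h 0"
      using \<theta>h by (simp add: h_def g_def k)
    then have "(\<Sum>i<length ys. (-1) ^ i * ys ! i * g i) + (-1) ^ length ys * var n * g (length ys) = h 0"
      unfolding len by (simp add: ys_def mult.assoc)
    moreover have "h 0 \<in> J"
    proof -
      have "n \<in> F 0"
      proof -
        have "3 * (k - 1) + 4 = n"
          using kpos k by linarith
        then show ?thesis
          using F_mem(2)[of 0 "k - 1"] kpos by simp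
      qed
      then show ?thesis
        unfolding h_def using var_times_sqfree_mon_mem[OF F_fin F_sub[of 0], of 1 n] n by auto
    qed
    ultimately show "(\<Sum>i<length ys. (-1) ^ i * ys ! i * g i) + (-1) ^ length ys * var n * g (length ys) \<in> J"
      by simp
  next
    \<comment> \<open>The functional separates \<open>g k\<close> from the ideal: facets of the
      cross-polytope are independent, so it vanishes on \<open>J\<close>, and by pairing it vanishes
      on multiples of \<open>\<theta> i\<close>. On \<open>g k\<close>, the monomial of the facet
      with B empty, its value is 1.\<close>
    have "cross_functional k p = 0" if "p \<in> foldl adjoin J ys" for p
    proof -
      from that obtain q a where a: "p = q + (\<Sum>i<length ys. ys ! i * a i)" "q \<in> J"
        unfolding foldl_adjoin[OF ideal ys] by auto
      have "cross_facet k B \<in> cycle_indep n" if B: "B \<subseteq> {..<k}" for B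
      proof -
        have sub: "1 \<le> v" "v < n" if "v \<in> cross_facet k B" for v
          using that B k unfolding cross_facet_def by auto
        have "Suc v \<notin> cross_facet k B" if v: "v \<in> cross_facet k B" for v
        proof
          assume Sv: "Suc v \<in> cross_facet k B"
          have mod: "u mod 3 = 1 \<or> u mod 3 = 2" if "u \<in> cross_facet k B" for u
          proof -
            have "\<exists>i. u = 3 * i + 1 \<or> u = 3 * i + 2"
              using that unfolding cross_facet_def by blast
            then show ?thesis
              by presburger
          qed
          have "v mod 3 = 1"
            using mod[OF v] mod[OF Sv] by presburger
          then have "v = 3 * (v div 3) + 1" "Suc v = 3 * (v div 3) + 2"
            by presburger+
          then show False
            using v Sv mem_cross_facet[of "v div 3" k B] by metis
        qed
        then show ?thesis
          using sub unfolding cycle_indep_def by fastforce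
      qed
      then have "cross_functional k q = 0"
        unfolding cross_functional_def using lookup_indicator_exp_J[OF a(2)] finite_cross_facet
        by (intro sum.neutral) auto
      moreover have "cross_functional k (ys ! i * a i) = 0" if "i < length ys" for i
        using that cross_functional_pair[of i k "a i"] by (simp add: ys_def \<theta>_def)
      ultimately show ?thesis
        unfolding a(1) by (simp add: cross_functional_add cross_functional_sum)
    qed
    moreover have "cross_functional k (g (length ys)) = 1"
    proof -
      have Fk: "F k = cross_facet k {}"
        by (simp add: F_def cross_facet_def)
      have "lookup (g k) (indicator_exp (cross_facet k B)) = (if B = {} then 1 else 0)"
        if "B \<in> Pow {..<k}" for B
      proof -
        have "indicator_exp (cross_facet k B) = indicator_exp (cross_facet k {}) \<longleftrightarrow> B = {}"
        proof
          assume "indicator_exp (cross_facet k B) = indicator_exp (cross_facet k {})"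
          then have "cross_facet k B = cross_facet k {}"
            using keys_indicator_exp finite_cross_facet that by (metis Pow_iff empty_subsetI)
          then show "B = {}"
            using mem_cross_facet(1) by blast
        qed simp
        then show ?thesis
          by (simp add: g_def sqfree_mon_def Fk lookup_single when_def eq_commute)
      qed
      then have "cross_functional k (g k) = (\<Sum>B\<in>Pow {..<k}. if B = {} then 1 else 0)"
        unfolding cross_functional_def by (intro sum.cong) auto
      then show ?thesis
        by (simp add: len)
    qed
    ultimately show "g (length ys) \<notin> foldl adjoin J ys"
      by fastforce
  qed
qed

lemma depth_cycle_le: "depth (graded_maximal_ideal n) M \<le> (n + 1) div 3"
proof (rule depth_le[OF graded_maximal_ideal_subset one_notin_J])
  fix fs assume fs: "set fs \<subseteq> graded_maximal_ideal n" "regular_on J fs"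
  show "length fs \<le> (n + 1) div 3"
  proof (cases "n mod 3 = 1")
    case True
    then have "n = 3 * (n div 3) + 1" "(n + 1) div 3 = n div 3"
      by presburger+
    then show ?thesis
      using regular_length_le_cross_polytope[OF _ fs] by simp
  next
    case False
    then show ?thesis
      using regular_length_le_facet fs by blast
  qed
qed

end

theorem proposition1p8:
  fixes n :: nat and J :: "'k::field mpoly set"
  assumes "n \<ge> 3" and "J = cycle_ideal n"
  shows "int (sdepth n (quot_module (poly_ring n) J) (quot_component n J)) \<ge> \<lceil>(real n - 1) / 3\<rceil>
    \<and> sdepth n (quot_module (poly_ring n) J) (quot_component n J)
        \<ge> depth (graded_maximal_ideal n) (quot_module (poly_ring n) J)"
proof -
  interpret cycle_quotient n J
    using assms cycle_ideal_eq by unfold_locales auto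
  \<comment> \<open>This is n - 1 \<le> 3 d without truncated subtraction; division by 3 bounds the
    ceiling.\<close>
  have "n \<le> 3 * ((n + 1) div 3) + 1"
    by presburger
  then have "real n \<le> real (3 * ((n + 1) div 3) + 1)"
    by (simp only: of_nat_le_iff)
  then have "\<lceil>(real n - 1) / 3\<rceil> \<le> int ((n + 1) div 3)"
    by (intro ceiling_le) simp
  then show ?thesis
    using sdepth_cycle_ge depth_cycle_le by linarith
qed

end
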